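(* Let $(M,g)$ be a compact smooth Riemannian manifold of dimension $m$ and let $1\le k\le m$. There exist a sequence $\{f_n\}_{n\in\mathbb{N}}\subset C^1(M,\mathbb{R}^k)$, bounded in the $C^1$-norm, with $$\lim_{n\to\infty}k(f_n)=+\infty,$$ and a constant $c_2=c_2(m)>0$, such that for every $n\in\mathbb{N}$ the zero set $Z(f_n)$ is regular and $$b(Z(f_n))\ge c_2\cdot k(f_n)^m .$$
   Context: $b(\cdot)$ denotes the sum of the Betti numbers. $Z(f)=\{x\in M: f(x)=0\}$; the zero set $Z(f)$ is regular if $0$ is a regular value of $f$, i.e. $\mathrm{rk}(D_xf)=k$ whenever $f(x)=0$. The $C^1$-norm is $\|f\|_{C^1}=\max_{x\in M}(\|f(x)\|+\|D_xf\|)$ with $\|D_xf\|=\max_{v\in T_xM,\|v\|_g=1}\|D_xf(v)\|$. The discriminant is $\Delta=\{f\in C^1(M,\mathbb{R}^k):\exists x\in M,\ f(x)=0,\ \mathrm{rk}(D_xf)<k\}$, $\delta(f)=\inf_{h\in\Delta}\|f-h\|_{C^1}$, and the condition number is $k(f)=\|f\|_{C^1}/\delta(f)$ (not to be confused with the integer $k$).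
   Formalization: The constant c_2 may depend on (M,g) and k, not only on m: on a circle of length L with m = k = 1 every regular f has b(Z(f)) ≤ (L/2) k(f), so no c_2(m) serves all L; M is also taken to be nonempty. *)

theory Defs
  imports "HOL-Analysis.Analysis" "HOL-Homology.Homology"
begin

subsection \<open>Differentiability classes\<close>

text \<open>Only meaningful for open \<open>S\<close>, where \<open>at x\<close> sees nothing but values on \<open>S\<close>.  In finite
  dimension, continuity of all directional derivatives \<open>x \<mapsto> Df(x) v\<close> is continuity of \<open>Df\<close>.\<close>

primrec Cn_on :: "nat \<Rightarrow> 'e::euclidean_space set \<Rightarrow> ('e \<Rightarrow> 'f::real_normed_vector) \<Rightarrow> bool" where
  "Cn_on 0 S f \<longleftrightarrow> continuous_on S f"
| "Cn_on (Suc n) S f \<longleftrightarrow>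
     (\<forall>x\<in>S. f differentiable (at x)) \<and> (\<forall>v. Cn_on n S (\<lambda>x. frechet_derivative f (at x) v))"

definition smooth_on :: "'e::euclidean_space set \<Rightarrow> ('e \<Rightarrow> 'f::real_normed_vector) \<Rightarrow> bool" where
  "smooth_on S f \<longleftrightarrow> (\<forall>n. Cn_on n S f)"

subsection \<open>Smooth manifolds\<close>

text \<open>A chart is a pair of its domain and its coordinate map; the dimension is \<open>CARD('m)\<close>.\<close>

type_synonym ('a, 'm) chart = "'a set \<times> ('a \<Rightarrow> real^'m)"

abbreviation chart_inv :: "('a, 'm::finite) chart \<Rightarrow> real^'m \<Rightarrow> 'a" where
  "chart_inv c \<equiv> inv_into (fst c) (snd c)"

definition smooth_manifold :: "'a topology \<Rightarrow> ('a, 'm::finite) chart set \<Rightarrow> bool" where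
  "smooth_manifold M A \<longleftrightarrow>
     Hausdorff_space M \<and> second_countable M \<and>
     (\<Union>c\<in>A. fst c) = topspace M \<and>
     (\<forall>c\<in>A. openin M (fst c) \<and> open (snd c ` fst c) \<and>
        homeomorphic_map (subtopology M (fst c)) (top_of_set (snd c ` fst c)) (snd c)) \<and>
     (\<forall>c\<in>A. \<forall>d\<in>A. smooth_on (snd c ` (fst c \<inter> fst d)) (snd d \<circ> chart_inv c))"

text \<open>A tangent vector at \<open>x\<close> is the family of its coordinate vectors in all charts around \<open>x\<close>,
  related by the derivatives of the transition maps, and extended by \<open>0\<close> to all other pairs.
  The vector space operations are pointwise.\<close>

type_synonym ('a, 'm) tangent_vector = "('a, 'm) chart \<Rightarrow> real^'m"

definition tangent_space ::
    "('a, 'm::finite) chart set \<Rightarrow> 'a \<Rightarrow> ('a, 'm) tangent_vector set" where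
  "tangent_space A x =
     {v. (\<forall>c\<in>A. \<forall>d\<in>A. x \<in> fst c \<and> x \<in> fst d \<longrightarrow>
            v d = frechet_derivative (snd d \<circ> chart_inv c) (at (snd c x)) (v c)) \<and>
         (\<forall>c. \<not> (c \<in> A \<and> x \<in> fst c) \<longrightarrow> v c = 0)}"

text \<open>The tangent vector at \<open>x\<close> whose coordinates in the chart \<open>c\<close> are \<open>u\<close>.\<close>

definition coord_vector ::
    "('a, 'm::finite) chart set \<Rightarrow> ('a, 'm) chart \<Rightarrow> 'a \<Rightarrow> real^'m \<Rightarrow> ('a, 'm) tangent_vector" where
  "coord_vector A c x u =
     (\<lambda>d. if d \<in> A \<and> x \<in> fst d
          then frechet_derivative (snd d \<circ> chart_inv c) (at (snd c x)) u else 0)"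

type_synonym ('a, 'm) metric_tensor =
  "'a \<Rightarrow> ('a, 'm) tangent_vector \<Rightarrow> ('a, 'm) tangent_vector \<Rightarrow> real"

definition riemannian_metric ::
    "'a topology \<Rightarrow> ('a, 'm::finite) chart set \<Rightarrow> ('a, 'm) metric_tensor \<Rightarrow> bool" where
  "riemannian_metric M A g \<longleftrightarrow>
     (\<forall>x\<in>topspace M.
        (\<forall>u\<in>tangent_space A x. \<forall>v\<in>tangent_space A x. g x u v = g x v u) \<and>
        (\<forall>u\<in>tangent_space A x. \<forall>v\<in>tangent_space A x. \<forall>w\<in>tangent_space A x. \<forall>a b.
           g x (\<lambda>c. a *\<^sub>R u c + b *\<^sub>R v c) w = a * g x u w + b * g x v w) \<and>
        (\<forall>v\<in>tangent_space A x. v \<noteq> (\<lambda>c. 0) \<longrightarrow> g x v v > 0)) \<and>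
     (\<forall>c\<in>A. \<forall>u w. smooth_on (snd c ` fst c)
        (\<lambda>y. let x = chart_inv c y in g x (coord_vector A c x u) (coord_vector A c x w)))"

subsection \<open>\<open>C\<^sup>1\<close> maps, discriminant and condition number\<close>

text \<open>Maps are total functions on \<open>'a\<close>; all notions below only depend on their values on
  \<open>topspace M\<close>.\<close>

definition C1_maps :: "('a, 'm::finite) chart set \<Rightarrow> ('a \<Rightarrow> real^'k) set" where
  "C1_maps A = {f. \<forall>c\<in>A. Cn_on 1 (snd c ` fst c) (f \<circ> chart_inv c)}"

text \<open>The differential \<open>D\<^sub>xf\<close> on \<open>tangent_space A x\<close>; by the chain rule the choice of the chart
  does not matter.\<close>

definition differential ::
    "('a, 'm::finite) chart set \<Rightarrow> ('a \<Rightarrow> real^'k) \<Rightarrow> 'a \<Rightarrow> ('a, 'm) tangent_vector \<Rightarrow> real^'k" where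
  "differential A f x v =
     (let c = (SOME c. c \<in> A \<and> x \<in> fst c)
      in frechet_derivative (f \<circ> chart_inv c) (at (snd c x)) (v c))"

definition differential_rank ::
    "('a, 'm::finite) chart set \<Rightarrow> ('a \<Rightarrow> real^'k) \<Rightarrow> 'a \<Rightarrow> nat" where
  "differential_rank A f x = dim (differential A f x ` tangent_space A x)"

definition differential_norm ::
    "('a, 'm::finite) chart set \<Rightarrow> ('a, 'm) metric_tensor \<Rightarrow> ('a \<Rightarrow> real^'k) \<Rightarrow> 'a \<Rightarrow> real" where
  "differential_norm A g f x =
     Sup {norm (differential A f x v) | v. v \<in> tangent_space A x \<and> sqrt (g x v v) = 1}"

definition C1_norm ::
    "'a topology \<Rightarrow> ('a, 'm::finite) chart set \<Rightarrow> ('a, 'm) metric_tensor \<Rightarrow> ('a \<Rightarrow> real^'k) \<Rightarrow> real" where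
  "C1_norm M A g f = (SUP x\<in>topspace M. norm (f x) + differential_norm A g f x)"

definition zero_set :: "'a topology \<Rightarrow> ('a \<Rightarrow> real^'k) \<Rightarrow> 'a set" where
  "zero_set M f = {x \<in> topspace M. f x = 0}"

definition regular_zero_set ::
    "'a topology \<Rightarrow> ('a, 'm::finite) chart set \<Rightarrow> ('a \<Rightarrow> real^'k) \<Rightarrow> bool" where
  "regular_zero_set M A f \<longleftrightarrow> (\<forall>x\<in>zero_set M f. differential_rank A f x = CARD('k))"

definition discriminant ::
    "'a topology \<Rightarrow> ('a, 'm::finite) chart set \<Rightarrow> ('a \<Rightarrow> real^'k) set" where
  "discriminant M A =
     {f \<in> C1_maps A. \<exists>x\<in>topspace M. f x = 0 \<and> differential_rank A f x < CARD('k)}"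

definition discriminant_dist ::
    "'a topology \<Rightarrow> ('a, 'm::finite) chart set \<Rightarrow> ('a, 'm) metric_tensor \<Rightarrow> ('a \<Rightarrow> real^'k) \<Rightarrow> real" where
  "discriminant_dist M A g f = (INF h\<in>discriminant M A. C1_norm M A g (\<lambda>x. f x - h x))"

text \<open>For \<open>f\<close> in the discriminant the quotient is \<open>0\<close> here instead of \<open>\<infinity>\<close>.\<close>

definition condition_number ::
    "'a topology \<Rightarrow> ('a, 'm::finite) chart set \<Rightarrow> ('a, 'm) metric_tensor \<Rightarrow> ('a \<Rightarrow> real^'k) \<Rightarrow> real" where
  "condition_number M A g f = C1_norm M A g f / discriminant_dist M A g f"

subsection \<open>Betti numbers\<close>

text \<open>The rank of an abelian group, written multiplicatively: the largest number of
  \<open>\<int>\<close>-linearly independent elements, possibly \<open>\<infinity>\<close>.\<close>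

definition int_independent :: "('g, 'b) monoid_scheme \<Rightarrow> 'g set \<Rightarrow> bool" where
  "int_independent G S \<longleftrightarrow>
     finite S \<and> S \<subseteq> carrier G \<and>
     (\<forall>n :: 'g \<Rightarrow> int. finprod G (\<lambda>s. s [^]\<^bsub>G\<^esub> n s) S = \<one>\<^bsub>G\<^esub> \<longrightarrow> (\<forall>s\<in>S. n s = 0))"

definition abelian_rank :: "('g, 'b) monoid_scheme \<Rightarrow> enat" where
  "abelian_rank G = (SUP S\<in>{S. int_independent G S}. enat (card S))"

definition betti :: "nat \<Rightarrow> 'a topology \<Rightarrow> enat" where
  "betti p X = abelian_rank (homology_group (int p) X)"

definition total_betti :: "'a topology \<Rightarrow> enat" where
  "total_betti X = suminf (\<lambda>p. betti p X)"

end

theory Submission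
  imports Defs
begin

text \<open>
  Why the theorem holds.  Write \<open>e = axis k0 1\<close>.  There is a \<open>C\<^sup>1\<close> map \<open>e + dent\<close> from
  \<open>\<real>\<^sup>m\<close> to \<open>\<real>\<^sup>k\<close> that is the constant \<open>e\<close> outside the unit ball, and whose zero set, a sphere
  of dimension \<open>m - k\<close> inside that ball, is non-empty and regular.  Inside one chart, pack of the
  order of \<open>\<epsilon>\<^sup>-\<^sup>m\<close> disjoint balls of radius \<open>\<epsilon>\<close>; put into each the rescaled copy
  \<open>\<epsilon> (e + dent ((y - p) / \<epsilon>))\<close> and let the map be the constant \<open>\<epsilon> e\<close> on the rest of the manifold.

  The rescaling keeps the first derivatives and multiplies the values by \<open>\<epsilon>\<close>.  Hence the
  \<open>C\<^sup>1\<close> norms stay bounded, and they also stay away from \<open>0\<close>, since the derivative at a zero is that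
  of the model.  The distance to the discriminant is of the exact order \<open>\<epsilon>\<close>.  It is at
  most \<open>\<epsilon>\<close>, because subtracting the constant \<open>\<epsilon> e\<close> creates a point where the value and the
  derivative both vanish (\<open>discriminant_near\<close>).  It is at least of order \<open>\<epsilon>\<close>, because by compactness the
  model satisfies a uniform bound: a value near \<open>0\<close> forces the derivative to be uniformly surjective
  (\<open>dent_nondegenerate\<close>), so that a map with a degenerate zero differs from the constructed one
  either by the order of \<open>\<epsilon>\<close> in value or by a constant in derivative (\<open>discriminant_far\<close>).  So the condition
  number is of order \<open>1 / \<epsilon>\<close>.

  The balls are disjoint and cut the zero set into non-empty relatively open pieces, one for each
  ball, so the zero set has at least \<open>\<epsilon>\<^sup>-\<^sup>m\<close> path components, up to a constant.  The zeroth homology is free abelian on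
  the path components, so this number bounds the zeroth Betti number, and a fortiori the sum of all of
  them, from below (\<open>total_betti_ge_card\<close>).

  The Riemannian metric and the compactness of the manifold enter through two facts: on a compact
  part of a chart the metric is comparable to the Euclidean metric of the coordinates (\<open>metric_norm_bounds\<close>), and the
  suprema in the \<open>C\<^sup>1\<close> norm are finite (\<open>C1_map_bounded\<close>), so that the norm does bound
  values and derivatives pointwise.
\<close>

section \<open>Betti numbers and path components\<close>

text \<open>An isomorphism carries a finite part of the basis of a free abelian group to an independent
  family; the coefficients of a relation are read off from the corresponding element of the free group.\<close>

lemma int_independent_free_basis:
  assumes G: "comm_group G" and h: "h \<in> iso (free_Abelian_group S) G"
    and T: "finite T" "T \<subseteq> S"
  shows "int_independent G ((h \<circ> frag_of) ` T)" "card ((h \<circ> frag_of) ` T) = card T"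
proof -
  interpret G: comm_group G by fact
  let ?F = "free_Abelian_group S"
  let ?b = "h \<circ> frag_of"
  have hom: "h \<in> hom ?F G" and bij: "bij_betw h (carrier ?F) (carrier G)"
    using h by (auto simp: iso_def)
  interpret h: group_hom ?F G h
    using hom by (simp add: group_hom.intro group_hom_axioms.intro G.group_axioms)
  have inj: "inj_on h (carrier ?F)" using bij by (simp add: bij_betw_def)
  have b_in: "frag_of C \<in> carrier ?F" if "C \<in> T" for C
    using that T by auto
  have injb: "inj_on ?b T"
    unfolding inj_on_def o_def using inj_onD[OF inj] b_in frag_of_eq by metis
  show "card (?b ` T) = card T"
    using injb by (rule card_image)
  have bG: "?b C \<in> carrier G" if "C \<in> T" for C
    using h.hom_closed[OF b_in[OF that]] by simp
  have prod: "finprod G (\<lambda>s. s [^]\<^bsub>G\<^esub> n s) (?b ` U) = h (\<Sum>C\<in>U. frag_cmul (n (?b C)) (frag_of C))"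
    if "U \<subseteq> T" for n :: "_ \<Rightarrow> int" and U
    using finite_subset[OF that T(1)] that
  proof (induction U rule: finite_induct)
    case empty
    have "h 0 = \<one>\<^bsub>G\<^esub>" using h.hom_one by simp
    then show ?case by simp
  next
    case (insert C U)
    have sumU: "(\<Sum>C\<in>U. frag_cmul (n (?b C)) (frag_of C)) \<in> carrier ?F"
      using insert.prems b_in by (intro sum_closed_free_Abelian_group) (auto simp: keys_cmul_iff split: if_splits)
    have cC: "frag_cmul (n (?b C)) (frag_of C) = frag_of C [^]\<^bsub>?F\<^esub> n (?b C)"
      using insert.prems T by (subst int_pow_free_Abelian_group) auto
    have new: "?b C \<notin> ?b ` U"
      using insert injb by (metis inj_on_image_mem_iff insert_subset)
    have "finprod G (\<lambda>s. s [^]\<^bsub>G\<^esub> n s) (?b ` insert C U)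
        = (?b C [^]\<^bsub>G\<^esub> n (?b C)) \<otimes>\<^bsub>G\<^esub> finprod G (\<lambda>s. s [^]\<^bsub>G\<^esub> n s) (?b ` U)"
      using new insert bG by (simp, subst G.finprod_insert) (auto intro!: G.int_pow_closed)
    also have "?b C [^]\<^bsub>G\<^esub> n (?b C) = h (frag_cmul (n (?b C)) (frag_of C))"
      unfolding cC unfolding o_def using insert.prems b_in[of C] h.hom_int_pow[of "frag_of C" "n (h (frag_of C))"]
      by (metis insert_subset)
    also have "finprod G (\<lambda>s. s [^]\<^bsub>G\<^esub> n s) (?b ` U) = h (\<Sum>C\<in>U. frag_cmul (n (?b C)) (frag_of C))"
      using insert by simp
    also have "h (frag_cmul (n (?b C)) (frag_of C)) \<otimes>\<^bsub>G\<^esub> h (\<Sum>C\<in>U. frag_cmul (n (?b C)) (frag_of C))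
       = h (\<Sum>C\<in>insert C U. frag_cmul (n (?b C)) (frag_of C))"
      using insert.hyps h.hom_mult[OF _ sumU, of "frag_cmul (n (?b C)) (frag_of C)"] b_in[of C] insert.prems
        h.G.int_pow_closed[of "frag_of C" "n (?b C)"] unfolding cC[symmetric]
      by simp
    finally show ?case .
  qed
  show "int_independent G (?b ` T)"
    unfolding int_independent_def
  proof (intro conjI allI impI ballI)
    show "finite (?b ` T)" "?b ` T \<subseteq> carrier G" using T bG by auto
    fix n :: "_ \<Rightarrow> int" and s
    assume one: "finprod G (\<lambda>s. s [^]\<^bsub>G\<^esub> n s) (?b ` T) = \<one>\<^bsub>G\<^esub>" and "s \<in> ?b ` T"
    then obtain C where C: "C \<in> T" "s = ?b C" by auto
    let ?x = "\<Sum>C\<in>T. frag_cmul (n (?b C)) (frag_of C)"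
    have xin: "?x \<in> carrier ?F"
      using T by (intro sum_closed_free_Abelian_group) (auto simp: keys_cmul_iff split: if_splits)
    have "h ?x = h 0" using prod[OF order.refl, of n] one h.hom_one by simp
    then have "?x = 0" using inj_onD[OF inj _ xin] by simp
    then have "0 = Poly_Mapping.lookup ?x C" by simp
    also have "\<dots> = (\<Sum>D\<in>T. if D = C then n (?b D) else 0)"
      by (auto simp: lookup_sum lookup_single when_def intro!: sum.cong)
    also have "\<dots> = n s" using C T by simp
    finally show "n s = 0" by simp
  qed
qed

lemma betti_0_ge_card:
  assumes "finite T" "T \<subseteq> path_components_of X"
  shows "enat (card T) \<le> betti 0 X"
proof -
  let ?H = "homology_group 0 X"
  have "free_Abelian_group (path_components_of X) \<cong> ?H"
    using zeroth_homology_group by (metis group.iso_sym group_relative_homology_group)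
  then obtain h where h: "h \<in> iso (free_Abelian_group (path_components_of X)) ?H"
    by (auto simp: is_iso_def)
  have "comm_group ?H" by (simp add: abelian_homology_group)
  note ind = int_independent_free_basis[OF this h assms]
  have "enat (card ((h \<circ> frag_of) ` T)) \<le> abelian_rank ?H"
    unfolding abelian_rank_def using ind(1) by (intro SUP_upper) simp
  then show ?thesis using ind(2) by (simp add: betti_def)
qed

text \<open>Points in different pieces of a partition into open sets lie in different path components,
  because a path-connected set meets only one piece.\<close>

lemma total_betti_ge_card:
  assumes "finite I"
    and opn: "\<And>v. v \<in> I \<Longrightarrow> openin X (U v)"
    and disj: "\<And>v w. v \<in> I \<Longrightarrow> w \<in> I \<Longrightarrow> v \<noteq> w \<Longrightarrow> U v \<inter> U w = {}"
    and cover: "topspace X \<subseteq> (\<Union>v\<in>I. U v)"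
    and ne: "\<And>v. v \<in> I \<Longrightarrow> U v \<noteq> {}"
  shows "enat (card I) \<le> total_betti X"
proof -
  define x where "x v = (SOME a. a \<in> U v)" for v
  have x: "x v \<in> U v" if "v \<in> I" for v
    using ne[OF that] unfolding x_def by (simp add: some_in_eq)
  have xX: "x v \<in> topspace X" if "v \<in> I" for v
    using x opn that openin_subset by blast
  let ?P = "\<lambda>v. path_component_of_set X (x v)"
  have "inj_on ?P I"
  proof (rule inj_onI, rule ccontr)
    fix v w assume vw: "v \<in> I" "w \<in> I" "?P v = ?P w" "v \<noteq> w"
    have conn: "connectedin X (?P v)"
      by (simp add: path_connectedin_imp_connectedin path_connectedin_path_component_of)
    have v: "x v \<in> ?P v" using xX[OF vw(1)] by (simp add: path_component_of_refl)
    have w: "x w \<in> ?P v" using xX[OF vw(2)] vw(3) by (simp add: path_component_of_refl)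
    let ?W = "\<Union>u\<in>I-{v}. U u"
    have "openin X ?W" using opn by blast
    moreover have "topspace X \<subseteq> U v \<union> ?W" using cover by blast
    then have "?P v \<subseteq> U v \<union> ?W" by (rule order_trans[OF path_component_of_subset_topspace])
    moreover have "U v \<inter> ?W \<inter> ?P v = {}" using disj vw(1) by auto
    ultimately have "U v \<inter> ?P v = {} \<or> ?W \<inter> ?P v = {}"
      using conn opn[OF vw(1)] unfolding connectedin by blast
    then show False using v w x[OF vw(1)] x[OF vw(2)] vw by blast
  qed
  then have "card (?P ` I) = card I" by (rule card_image)
  moreover have "?P ` I \<subseteq> path_components_of X"
    using xX by (auto simp: path_component_in_path_components_of)
  ultimately have "enat (card I) \<le> betti 0 X"
    using betti_0_ge_card[of "?P ` I" X] assms(1) by simp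
  also have "\<dots> \<le> total_betti X"
    unfolding total_betti_def using sum_le_suminf[of "\<lambda>p. betti p X" "{0}"] by simp
  finally show ?thesis .
qed

section \<open>Maps of class \<open>C\<^sup>1\<close> on open sets\<close>

lemma Cn_on_1_iff:
  "Cn_on 1 S f \<longleftrightarrow> (\<forall>x\<in>S. f differentiable (at x)) \<and>
     (\<forall>v. continuous_on S (\<lambda>x. frechet_derivative f (at x) v))"
  unfolding One_nat_def by simp

lemma Cn_on_1I:
  assumes "\<And>x. x \<in> S \<Longrightarrow> (f has_derivative f' x) (at x)"
    and "\<And>v. continuous_on S (\<lambda>x. f' x v)"
  shows "Cn_on 1 S f"
proof -
  have "frechet_derivative f (at x) = f' x" if "x \<in> S" for x
    using frechet_derivative_at[OF assms(1)[OF that]] by simp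
  then show ?thesis
    unfolding Cn_on_1_iff using assms by (auto simp: differentiable_def cong: continuous_on_cong)
qed

lemma Cn_on_1D:
  assumes "Cn_on 1 S f" "x \<in> S"
  shows "(f has_derivative frechet_derivative f (at x)) (at x)"
  using assms unfolding Cn_on_1_iff by (simp add: frechet_derivative_works)

lemma Cn_on_1_continuous_deriv:
  "Cn_on 1 S f \<Longrightarrow> continuous_on S (\<lambda>x. frechet_derivative f (at x) v)"
  by (simp add: Cn_on_1_iff)

lemma Cn_on_1_imp_continuous_on: "Cn_on 1 S f \<Longrightarrow> continuous_on S f"
  unfolding Cn_on_1_iff
  by (intro differentiable_imp_continuous_on) (auto simp: differentiable_on_def intro: differentiable_at_withinI)

lemma Cn_on_1_const: "Cn_on 1 S (\<lambda>x. k)"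
  by (rule Cn_on_1I[where f' = "\<lambda>x v. 0"]) auto

lemma Cn_on_1_diff:
  assumes "Cn_on 1 S f" "Cn_on 1 S h"
  shows "Cn_on 1 S (\<lambda>x. f x - h x)"
  by (rule Cn_on_1I[OF has_derivative_diff[OF Cn_on_1D[OF assms(1)] Cn_on_1D[OF assms(2)]]])
    (auto intro!: continuous_intros Cn_on_1_continuous_deriv assms)

lemma Cn_on_1_cong:
  assumes "open S" "Cn_on 1 S f" "\<And>x. x \<in> S \<Longrightarrow> f x = h x"
  shows "Cn_on 1 S h"
proof (rule Cn_on_1I)
  show "(h has_derivative frechet_derivative f (at x)) (at x)" if "x \<in> S" for x
    using has_derivative_transform_within_open[OF Cn_on_1D[OF assms(2) that] assms(1) that assms(3)] .
qed (rule Cn_on_1_continuous_deriv[OF assms(2)])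

lemma Cn_on_1_Un:
  assumes "open S" "open T" "Cn_on 1 S f" "Cn_on 1 T f"
  shows "Cn_on 1 (S \<union> T) f"
  using assms unfolding Cn_on_1_iff by (auto intro: continuous_on_open_Un)

lemma linear_sum_Basis:
  fixes f :: "'a::euclidean_space \<Rightarrow> 'b::real_vector"
  assumes "linear f"
  shows "f u = (\<Sum>b\<in>Basis. (u \<bullet> b) *\<^sub>R f b)"
proof -
  have "f u = f (\<Sum>b\<in>Basis. (u \<bullet> b) *\<^sub>R b)" by (simp add: euclidean_representation)
  also have "\<dots> = (\<Sum>b\<in>Basis. (u \<bullet> b) *\<^sub>R f b)"
    using assms by (simp add: linear_sum linear_scale)
  finally show ?thesis .
qed

lemma Cn_on_1_compose:
  fixes f :: "'b::euclidean_space \<Rightarrow> 'c::real_normed_vector"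
  assumes "Cn_on 1 S h" "Cn_on 1 T f" "h ` S \<subseteq> T"
  shows "Cn_on 1 S (f \<circ> h)"
proof (rule Cn_on_1I)
  let ?Dh = "\<lambda>x. frechet_derivative h (at x)" and ?Df = "\<lambda>y. frechet_derivative f (at y)"
  show "((f \<circ> h) has_derivative (\<lambda>v. ?Df (h x) (?Dh x v))) (at x)" if "x \<in> S" for x
    using diff_chain_at[OF Cn_on_1D[OF assms(1) that] Cn_on_1D[OF assms(2), of "h x"]] assms(3) that
    by (auto simp: o_def)
  have "continuous_on S (\<lambda>x. \<Sum>b\<in>Basis. (?Dh x v \<bullet> b) *\<^sub>R ?Df (h x) b)" for v
  proof (intro continuous_intros Cn_on_1_continuous_deriv[OF assms(1)])
    show "continuous_on S (\<lambda>x. ?Df (h x) b)" for b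
      using continuous_on_compose2[OF Cn_on_1_continuous_deriv[OF assms(2)] Cn_on_1_imp_continuous_on[OF assms(1)] assms(3)] .
  qed
  moreover have "?Df (h x) (?Dh x v) = (\<Sum>b\<in>Basis. (?Dh x v \<bullet> b) *\<^sub>R ?Df (h x) b)" if "x \<in> S" for x v
    using has_derivative_linear[OF Cn_on_1D[OF assms(2), of "h x"]] assms(3) that
    by (intro linear_sum_Basis) auto
  ultimately show "continuous_on S (\<lambda>x. ?Df (h x) (?Dh x v))" for v
    by (simp cong: continuous_on_cong)
qed

section \<open>The model map on the unit ball\<close>

text \<open>Squaring smooths the corner of the positive part: the error of the linear approximation is at
  most \<open>h\<^sup>2\<close>.  This makes \<open>bump\<close> below a compactly supported map of class \<open>C\<^sup>1\<close> that is a
  polynomial inside the unit ball.\<close>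

lemma has_derivative_pos_part_squared:
  "((\<lambda>t::real. (max 0 t)\<^sup>2) has_real_derivative 2 * max 0 t) (at t)"
proof -
  have "((\<lambda>h. ((max 0 (t + h))\<^sup>2 - (max 0 t)\<^sup>2) / h - 2 * max 0 t) \<longlongrightarrow> 0) (at 0)"
  proof (rule Lim_null_comparison)
    have "norm (((max 0 (t + h))\<^sup>2 - (max 0 t)\<^sup>2) / h - 2 * max 0 t) \<le> \<bar>h\<bar>" if "h \<noteq> 0" for h
    proof -
      have "\<bar>(max 0 (t + h))\<^sup>2 - (max 0 t)\<^sup>2 - 2 * max 0 t * h\<bar> \<le> h\<^sup>2"
      proof -
        consider "t \<ge> 0" "t + h \<ge> 0" | "t \<ge> 0" "t + h < 0" | "t < 0" "t + h \<ge> 0" | "t < 0" "t + h < 0"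
          by linarith
        then show ?thesis
        proof cases
          case 2
          have "t * (2 * h + t) \<le> 0" using 2 by (intro mult_nonneg_nonpos) auto
          moreover have "(t + h)\<^sup>2 \<ge> 0" by simp
          moreover have "- t\<^sup>2 - 2*t*h - h\<^sup>2 \<le> 0" using zero_le_power2[of "t+h"] by (simp add: power2_sum)
          ultimately show ?thesis using 2 by (simp add: max_def power2_eq_square algebra_simps abs_le_iff)
        next
          case 3
          have "(t + h)\<^sup>2 \<le> h\<^sup>2" using 3 by (intro power_mono) auto
          then show ?thesis using 3 by (simp add: max_def)
        qed (auto simp: max_def power2_eq_square algebra_simps)
      qed
      then have "\<bar>((max 0 (t + h))\<^sup>2 - (max 0 t)\<^sup>2 - 2 * max 0 t * h) / h\<bar> \<le> h\<^sup>2 / \<bar>h\<bar>"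
        by (simp add: abs_divide divide_right_mono)
      also have "h\<^sup>2 / \<bar>h\<bar> = \<bar>h\<bar>"
        by (simp add: power2_eq_square divide_simps)
      also have "((max 0 (t + h))\<^sup>2 - (max 0 t)\<^sup>2 - 2 * max 0 t * h) / h = ((max 0 (t + h))\<^sup>2 - (max 0 t)\<^sup>2) / h - 2 * max 0 t"
        using that by (simp add: field_simps)
      finally show ?thesis by simp
    qed
    then show "\<forall>\<^sub>F h in at 0. norm (((max 0 (t + h))\<^sup>2 - (max 0 t)\<^sup>2) / h - 2 * max 0 t) \<le> \<bar>h\<bar>"
      by (auto simp: eventually_at_filter)
    show "((\<lambda>h::real. \<bar>h\<bar>) \<longlongrightarrow> 0) (at 0)"
      by (intro tendsto_rabs_zero tendsto_ident_at)
  qed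
  then show ?thesis
    unfolding has_field_derivative_def DERIV_def[unfolded has_field_derivative_def]
    by (simp add: Lim_null[symmetric])
qed

definition bump :: "real^'m \<Rightarrow> real" where
  "bump y = (max 0 (1 - y \<bullet> y))\<^sup>2"

lemma bump_outside: "norm y \<ge> 1 \<Longrightarrow> 1 - y \<bullet> y \<le> 0" "norm y \<ge> 1 \<Longrightarrow> bump y = 0"
proof -
  show 1: "1 - y \<bullet> y \<le> 0" if "norm y \<ge> 1" for y :: "real^'m"
    using power_mono[OF that, of 2] by (simp add: dot_square_norm)
  show "norm y \<ge> 1 \<Longrightarrow> bump y = 0" for y :: "real^'m"
    using 1[of y] by (simp add: bump_def max_def)
qed

lemma has_derivative_bump:
  "(bump has_derivative (\<lambda>u. - 4 * max 0 (1 - y \<bullet> y) * (y \<bullet> u))) (at y)"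
proof -
  have "((\<lambda>y. 1 - y \<bullet> y) has_derivative (\<lambda>u. - 2 * (y \<bullet> u))) (at y)"
    by (auto intro!: derivative_eq_intros simp: inner_commute)
  from has_derivative_compose[OF this has_derivative_pos_part_squared[unfolded has_field_derivative_def]]
  show ?thesis unfolding bump_def by (simp add: mult.assoc mult.left_commute)
qed

definition tail_coords :: "'k \<Rightarrow> ('k \<Rightarrow> 'm) \<Rightarrow> real^'m \<Rightarrow> real^'k" where
  "tail_coords k0 \<iota> u = (\<chi> j. if j = k0 then 0 else u $ \<iota> j)"

text \<open>With \<open>j\<close> ranging over the indices other than \<open>k0\<close>, the map \<open>axis k0 1 + dent k0 \<iota>\<close> has
  the components \<open>1 - 4 bump y\<close> at \<open>k0\<close> and \<open>bump y * y $ \<iota> j\<close> at \<open>j\<close>.  It vanishes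
  where \<open>bump y = 1/4\<close>, that is \<open>norm y ^ 2 = 1/2\<close>, and all \<open>y $ \<iota> j = 0\<close>: for injective
  \<open>\<iota>\<close> a sphere in a linear subspace of dimension \<open>m - k + 1\<close>.\<close>

definition dent :: "'k \<Rightarrow> ('k \<Rightarrow> 'm) \<Rightarrow> real^'m \<Rightarrow> real^'k" where
  "dent k0 \<iota> y = bump y *\<^sub>R (tail_coords k0 \<iota> y - 4 *\<^sub>R axis k0 1)"

definition dent_deriv :: "'k \<Rightarrow> ('k \<Rightarrow> 'm) \<Rightarrow> real^'m \<Rightarrow> real^'m \<Rightarrow> real^'k" where
  "dent_deriv k0 \<iota> y u = (- 4 * max 0 (1 - y \<bullet> y) * (y \<bullet> u)) *\<^sub>R (tail_coords k0 \<iota> y - 4 *\<^sub>R axis k0 1)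
     + bump y *\<^sub>R tail_coords k0 \<iota> u"

lemma linear_tail_coords: "linear (tail_coords k0 \<iota>)"
  by (intro linearI) (auto simp: tail_coords_def vec_eq_iff)

lemma bounded_linear_tail_coords: "bounded_linear (tail_coords k0 \<iota> :: real^'m::finite \<Rightarrow> real^'k::finite)"
  using linear_tail_coords linear_conv_bounded_linear by blast

lemma has_derivative_dent:
  fixes k0 :: "'k::finite" and \<iota> :: "'k \<Rightarrow> 'm::finite"
  shows "(dent k0 \<iota> has_derivative dent_deriv k0 \<iota> y) (at y)"
proof -
  have "(tail_coords k0 \<iota> has_derivative tail_coords k0 \<iota>) (at y)"
    using bounded_linear_tail_coords by (rule bounded_linear_imp_has_derivative)
  then have "((\<lambda>y. tail_coords k0 \<iota> y - 4 *\<^sub>R axis k0 1) has_derivative (\<lambda>u. tail_coords k0 \<iota> u)) (at y)"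
    by (auto intro!: derivative_eq_intros)
  from has_derivative_scaleR[OF has_derivative_bump this]
  show ?thesis unfolding dent_def[abs_def] dent_deriv_def[abs_def]
    by (simp add: add.commute)
qed

lemma dent_outside:
  assumes "norm y \<ge> 1"
  shows "dent k0 \<iota> y = 0" "dent_deriv k0 \<iota> y = (\<lambda>u. 0)"
  using bump_outside[OF assms] by (auto simp: dent_def dent_deriv_def max_def)

lemma continuous_on_bump [continuous_intros]:
  "continuous_on S f \<Longrightarrow> continuous_on S (\<lambda>x. bump (f x))"
  unfolding bump_def by (intro continuous_intros)

lemma continuous_on_dent_deriv:
  fixes k0 :: "'k::finite" and \<iota> :: "'k \<Rightarrow> 'm::finite"
  assumes "continuous_on S f" "continuous_on S h"
  shows "continuous_on S (\<lambda>x. dent_deriv k0 \<iota> (f x) (h x))"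
  unfolding dent_deriv_def
  by (intro continuous_intros assms bounded_linear.continuous_on[OF bounded_linear_tail_coords])

lemma linear_dent_deriv: "linear (dent_deriv k0 \<iota> y)"
  for k0 :: "'k::finite" and \<iota> :: "'k \<Rightarrow> 'm::finite"
  using has_derivative_dent by (rule has_derivative_linear)

text \<open>A covector \<open>\<mu>\<close> that kills the derivative at a zero \<open>z\<close> is tested against two kinds of
  directions.  The radial direction \<open>z\<close> changes only the component \<open>k0\<close>, and the direction \<open>axis (\<iota> j) 1\<close>, being
  orthogonal to \<open>z\<close>, changes only the component \<open>j\<close>.\<close>

lemma dent_regular_zero:
  fixes k0 :: "'k::finite" and \<iota> :: "'k \<Rightarrow> 'm::finite"
  assumes inj: "inj \<iota>" and zero: "axis k0 1 + dent k0 \<iota> z = 0"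
    and orth: "\<And>u. \<mu> \<bullet> dent_deriv k0 \<iota> z u = 0"
  shows "\<mu> = 0"
proof -
  have comp: "axis k0 1 $ j + dent k0 \<iota> z $ j = 0" for j
    using zero by (metis vector_add_component zero_index)
  have b: "bump z = 1/4"
    using comp[of k0] by (simp add: dent_def tail_coords_def axis_def)
  have s: "max 0 (1 - z \<bullet> z) = 1/2"
  proof -
    have "(max 0 (1 - z \<bullet> z))\<^sup>2 = (1/2)\<^sup>2" using b by (simp add: bump_def power2_eq_square)
    then show ?thesis by (rule power2_eq_imp_eq) auto
  qed
  have zz: "z \<bullet> z = 1/2" using s by (simp add: max_def split: if_splits)
  have zj: "z $ \<iota> j = 0" if "j \<noteq> k0" for j
    using comp[of j] b that by (simp add: dent_def tail_coords_def axis_def)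
  have tz: "tail_coords k0 \<iota> z = 0"
    using zj by (auto simp: tail_coords_def vec_eq_iff)
  have k: "\<mu> $ k0 = 0"
    using orth[of z] by (simp add: dent_deriv_def s b zz tz inner_axis)
  have j: "\<mu> $ j = 0" if "j \<noteq> k0" for j
  proof -
    have "tail_coords k0 \<iota> (axis (\<iota> j) 1) = axis j 1"
      using inj that by (auto simp: tail_coords_def axis_def vec_eq_iff inj_eq)
    then show ?thesis
      using orth[of "axis (\<iota> j) 1"] by (simp add: dent_deriv_def s b inner_axis zj[OF that])
  qed
  show ?thesis using k j by (metis vec_eq_iff zero_index)
qed

text \<open>The gradient of the real function \<open>\<mu> \<bullet> dent\<close>, that is, the transposed derivative applied to
  \<open>\<mu>\<close>.  As a function of both arguments it is continuous by inspection, which the compactness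
  argument below uses.\<close>

definition dent_grad :: "'k::finite \<Rightarrow> ('k \<Rightarrow> 'm::finite) \<Rightarrow> real^'m \<Rightarrow> real^'k \<Rightarrow> real^'m" where
  "dent_grad k0 \<iota> y \<mu> = (- 4 * max 0 (1 - y \<bullet> y) * (\<mu> \<bullet> (tail_coords k0 \<iota> y - 4 *\<^sub>R axis k0 1))) *\<^sub>R y
     + bump y *\<^sub>R adjoint (tail_coords k0 \<iota>) \<mu>"

lemma inner_dent_grad: "dent_grad k0 \<iota> y \<mu> \<bullet> u = \<mu> \<bullet> dent_deriv k0 \<iota> y u"
proof -
  have "adjoint (tail_coords k0 \<iota>) \<mu> \<bullet> u = \<mu> \<bullet> tail_coords k0 \<iota> u"
    using adjoint_works[OF linear_tail_coords[of k0 \<iota>], of u \<mu>] by (simp add: inner_commute)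
  then show ?thesis
    by (simp add: dent_grad_def dent_deriv_def inner_simps algebra_simps)
qed

text \<open>The quantitative form of regularity.  The sum on the right is continuous on the compact
  product of the ball and the sphere, and by \<open>dent_regular_zero\<close> it has no zero there.  The bound \<open>c \<le> 1\<close>
  lets the same constant serve where the map is constant and has norm \<open>1\<close>.\<close>

lemma dent_nondegenerate:
  fixes k0 :: "'k::finite" and \<iota> :: "'k \<Rightarrow> 'm::finite"
  assumes inj: "inj \<iota>"
  obtains c where "c > 0" "c \<le> 1"
    "\<And>z \<mu>. norm z \<le> 1 \<Longrightarrow> norm \<mu> = 1 \<Longrightarrow> c \<le> norm (axis k0 1 + dent k0 \<iota> z) + norm (dent_grad k0 \<iota> z \<mu>)"
proof -
  let ?K = "cball 0 1 \<times> sphere 0 1 :: ((real^'m) \<times> (real^'k)) set"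
  let ?h = "\<lambda>(z, \<mu>). norm (axis k0 1 + dent k0 \<iota> z) + norm (dent_grad k0 \<iota> z \<mu>)"
  have cont: "continuous_on ?K ?h"
  proof -
    have "bounded_linear (adjoint (tail_coords k0 \<iota>))"
      using adjoint_linear[OF linear_tail_coords[of k0 \<iota>]] linear_conv_bounded_linear by blast
    note 1 = bounded_linear.continuous_on[OF this]
    show ?thesis unfolding case_prod_beta dent_def dent_grad_def
      by (intro continuous_intros 1 bounded_linear.continuous_on[OF bounded_linear_tail_coords])
  qed
  have "axis k0 1 \<in> (sphere 0 1 :: (real^'k) set)" by (simp add: norm_axis_1)
  then have ne: "?K \<noteq> {}" by auto
  have "compact ?K" by (intro compact_Times compact_cball compact_sphere)
  from continuous_attains_inf[OF this ne cont]
  obtain z \<mu> where z: "norm z \<le> 1" "norm \<mu> = 1" and min: "\<forall>x\<in>?K. ?h (z, \<mu>) \<le> ?h x"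
    by auto
  have "?h (z, \<mu>) \<noteq> 0"
  proof
    assume "?h (z, \<mu>) = 0"
    then have "axis k0 1 + dent k0 \<iota> z = 0" "dent_grad k0 \<iota> z \<mu> = 0"
      by (auto simp: add_nonneg_eq_0_iff)
    then have "\<mu> = 0"
      using dent_regular_zero[OF inj, of k0 z \<mu>] inner_dent_grad by (metis inner_zero_left)
    then show False using z by simp
  qed
  then have "?h (z, \<mu>) > 0" by (simp add: less_le)
  then show ?thesis
    using that[of "min 1 (?h (z, \<mu>))"] min by (force simp: min_le_iff_disj)
qed

lemma dent_bounded:
  fixes k0 :: "'k::finite" and \<iota> :: "'k \<Rightarrow> 'm::finite"
  obtains C where "C \<ge> 1" "\<And>z. norm z \<le> 1 \<Longrightarrow> norm (axis k0 1 + dent k0 \<iota> z) \<le> C"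
    "\<And>z u. norm z \<le> 1 \<Longrightarrow> norm (dent_deriv k0 \<iota> z u) \<le> C * norm u"
proof -
  let ?N = "\<lambda>z. norm (axis k0 1 + dent k0 \<iota> z) + (\<Sum>b\<in>Basis. norm (dent_deriv k0 \<iota> z b))"
  have "continuous_on (cball 0 1) ?N"
    unfolding dent_def
    by (intro continuous_intros continuous_on_dent_deriv
      bounded_linear.continuous_on[OF bounded_linear_tail_coords])
  then have "compact (?N ` cball 0 1)" by (intro compact_continuous_image compact_cball)
  from compact_imp_bounded[OF this] obtain C where "\<forall>t\<in>?N ` cball 0 1. norm t \<le> C"
    unfolding bounded_iff by (rule exE)
  then have C: "?N z \<le> C" if "norm z \<le> 1" for z
    using that by (auto intro: order_trans[OF abs_ge_self])
  show ?thesis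
  proof (rule that[of "max C 1"])
    fix z :: "real^'m" assume z: "norm z \<le> 1"
    have "(\<Sum>b\<in>Basis. norm (dent_deriv k0 \<iota> z b)) \<ge> 0" by (intro sum_nonneg) auto
    then show "norm (axis k0 1 + dent k0 \<iota> z) \<le> max C 1" using C[OF z] by linarith
    have S: "(\<Sum>b\<in>Basis. norm (dent_deriv k0 \<iota> z b)) \<le> max C 1"
      using C[OF z] norm_ge_zero[of "axis k0 1 + dent k0 \<iota> z"] by linarith
    fix u
    have "norm (dent_deriv k0 \<iota> z u) = norm (\<Sum>b\<in>Basis. (u \<bullet> b) *\<^sub>R dent_deriv k0 \<iota> z b)"
      using linear_sum_Basis[OF linear_dent_deriv[of k0 \<iota> z], of u] by simp
    also have "\<dots> \<le> (\<Sum>b\<in>Basis. norm u * norm (dent_deriv k0 \<iota> z b))"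
      by (intro sum_norm_le) (simp add: Basis_le_norm mult_right_mono)
    also have "\<dots> \<le> norm u * max C 1"
      unfolding sum_distrib_left[symmetric] using S by (intro mult_left_mono) auto
    finally show "norm (dent_deriv k0 \<iota> z u) \<le> max C 1 * norm u"
      by (simp add: mult.commute)
  qed simp
qed

lemma dent_zero_exists:
  fixes k0 :: "'k::finite" and \<iota> :: "'k \<Rightarrow> 'm::finite"
  assumes inj: "inj \<iota>"
  obtains z where "norm z < 1" "axis k0 1 + dent k0 \<iota> z = 0"
proof
  let ?z = "sqrt (1/2) *\<^sub>R axis (\<iota> k0) 1 :: real^'m"
  show "norm ?z < 1" by (simp add: norm_axis_1 real_sqrt_divide)
  have "?z \<bullet> ?z = 1/2" by (simp add: inner_axis_axis)
  then have "bump ?z = 1/4" unfolding bump_def by (simp only:) (simp add: power2_eq_square)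
  moreover have "tail_coords k0 \<iota> ?z = 0"
    using inj by (auto simp: tail_coords_def vec_eq_iff axis_def inj_eq)
  ultimately show "axis k0 1 + dent k0 \<iota> ?z = 0" by (simp add: dent_def)
qed

section \<open>Rescaled copies of the model in disjoint balls\<close>

lemma norm_rescaled: "\<epsilon> > 0 \<Longrightarrow> norm ((y - p) /\<^sub>R \<epsilon>) = dist p y / \<epsilon>"
  by (simp add: dist_norm norm_minus_commute divide_inverse mult.commute)


text \<open>Scaling the argument by \<open>1 / \<epsilon>\<close> and the value by \<open>\<epsilon>\<close> leaves derivatives
  unscaled, so that \<open>\<epsilon>\<close> enters the derivative \<open>dented_deriv\<close> only through the
  argument.\<close>

definition dented :: "'k \<Rightarrow> ('k \<Rightarrow> 'm) \<Rightarrow> real \<Rightarrow> 'i set \<Rightarrow> ('i \<Rightarrow> real^'m) \<Rightarrow> real^'m \<Rightarrow> real^'k" where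
  "dented k0 \<iota> \<epsilon> I p y = \<epsilon> *\<^sub>R (axis k0 1 + (\<Sum>v\<in>I. dent k0 \<iota> ((y - p v) /\<^sub>R \<epsilon>)))"

definition dented_deriv :: "'k \<Rightarrow> ('k \<Rightarrow> 'm) \<Rightarrow> real \<Rightarrow> 'i set \<Rightarrow> ('i \<Rightarrow> real^'m) \<Rightarrow> real^'m \<Rightarrow> real^'m \<Rightarrow> real^'k" where
  "dented_deriv k0 \<iota> \<epsilon> I p y u = (\<Sum>v\<in>I. dent_deriv k0 \<iota> ((y - p v) /\<^sub>R \<epsilon>) u)"

lemma has_derivative_dented:
  fixes k0 :: "'k::finite" and \<iota> :: "'k \<Rightarrow> 'm::finite"
  assumes "\<epsilon> > 0"
  shows "(dented k0 \<iota> \<epsilon> I p has_derivative dented_deriv k0 \<iota> \<epsilon> I p y) (at y)"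
proof -
  have "((\<lambda>y. dent k0 \<iota> ((y - p v) /\<^sub>R \<epsilon>)) has_derivative (\<lambda>u. dent_deriv k0 \<iota> ((y - p v) /\<^sub>R \<epsilon>) (u /\<^sub>R \<epsilon>))) (at y)" for v
  proof -
    have "((\<lambda>y. (y - p v) /\<^sub>R \<epsilon>) has_derivative (\<lambda>u. u /\<^sub>R \<epsilon>)) (at y)"
      by (auto intro!: derivative_eq_intros)
    from has_derivative_compose[OF this has_derivative_dent] show ?thesis .
  qed
  then have "(dented k0 \<iota> \<epsilon> I p has_derivative (\<lambda>u. \<epsilon> *\<^sub>R (\<Sum>v\<in>I. dent_deriv k0 \<iota> ((y - p v) /\<^sub>R \<epsilon>) (u /\<^sub>R \<epsilon>)))) (at y)"
    unfolding dented_def[abs_def] by (auto intro!: derivative_eq_intros)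
  moreover have "\<epsilon> *\<^sub>R (\<Sum>v\<in>I. dent_deriv k0 \<iota> ((y - p v) /\<^sub>R \<epsilon>) (u /\<^sub>R \<epsilon>)) = dented_deriv k0 \<iota> \<epsilon> I p y u" for u
    using assms by (simp add: dented_deriv_def linear_scale[OF linear_dent_deriv] scaleR_sum_right)
  ultimately show ?thesis by simp
qed

lemma continuous_on_dented_deriv:
  fixes k0 :: "'k::finite" and \<iota> :: "'k \<Rightarrow> 'm::finite"
  shows "continuous_on S (\<lambda>y. dented_deriv k0 \<iota> \<epsilon> I p y u)"
  unfolding dented_deriv_def by (intro continuous_intros continuous_on_dent_deriv)

lemma dented_in_ball:
  fixes k0 :: "'k::finite" and \<iota> :: "'k \<Rightarrow> 'm::finite"
  assumes "\<epsilon> > 0" "finite I" and sep: "\<And>v w. v \<in> I \<Longrightarrow> w \<in> I \<Longrightarrow> v \<noteq> w \<Longrightarrow> dist (p v) (p w) \<ge> 2 * \<epsilon>"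
    and v: "v \<in> I" "dist (p v) y < \<epsilon>"
  shows "dented k0 \<iota> \<epsilon> I p y = \<epsilon> *\<^sub>R (axis k0 1 + dent k0 \<iota> ((y - p v) /\<^sub>R \<epsilon>))"
    "dented_deriv k0 \<iota> \<epsilon> I p y = dent_deriv k0 \<iota> ((y - p v) /\<^sub>R \<epsilon>)"
proof -
  have far: "norm ((y - p w) /\<^sub>R \<epsilon>) \<ge> 1" if "w \<in> I - {v}" for w
  proof -
    have "2 * \<epsilon> \<le> dist (p v) (p w)" using that v(1) by (intro sep) auto
    then have "\<epsilon> \<le> dist y (p w)"
      using v(2) dist_triangle[of "p v" "p w" y] by linarith
    then show ?thesis using assms(1) by (simp add: norm_rescaled dist_commute del: norm_scaleR)
  qed
  have "(\<Sum>w\<in>I. dent k0 \<iota> ((y - p w) /\<^sub>R \<epsilon>)) = dent k0 \<iota> ((y - p v) /\<^sub>R \<epsilon>)"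
    using assms(2) v(1) far by (subst sum.remove[of I v]) (auto simp: dent_outside(1))
  then show "dented k0 \<iota> \<epsilon> I p y = \<epsilon> *\<^sub>R (axis k0 1 + dent k0 \<iota> ((y - p v) /\<^sub>R \<epsilon>))"
    by (simp add: dented_def)
  have "(\<Sum>w\<in>I. dent_deriv k0 \<iota> ((y - p w) /\<^sub>R \<epsilon>) u) = dent_deriv k0 \<iota> ((y - p v) /\<^sub>R \<epsilon>) u" for u
    using assms(2) v(1) far by (subst sum.remove[of I v]) (auto simp: dent_outside(2))
  then show "dented_deriv k0 \<iota> \<epsilon> I p y = dent_deriv k0 \<iota> ((y - p v) /\<^sub>R \<epsilon>)"
    by (auto simp: dented_deriv_def)
qed

lemma dented_outside:
  fixes k0 :: "'k::finite" and \<iota> :: "'k \<Rightarrow> 'm::finite"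
  assumes "\<epsilon> > 0" and far: "\<And>v. v \<in> I \<Longrightarrow> dist (p v) y \<ge> \<epsilon>"
  shows "dented k0 \<iota> \<epsilon> I p y = \<epsilon> *\<^sub>R axis k0 1"
    "dented_deriv k0 \<iota> \<epsilon> I p y = (\<lambda>u. 0)"
proof -
  have "norm ((y - p w) /\<^sub>R \<epsilon>) \<ge> 1" if "w \<in> I" for w
    using far[OF that] assms(1) by (simp add: norm_rescaled del: norm_scaleR)
  then show "dented k0 \<iota> \<epsilon> I p y = \<epsilon> *\<^sub>R axis k0 1" "dented_deriv k0 \<iota> \<epsilon> I p y = (\<lambda>u. 0)"
    by (auto simp: dented_def dented_deriv_def dent_outside)
qed

text \<open>At every point value and derivative are those of one rescaled copy of the model.
  Away from all balls a point of the unit sphere serves as \<open>z\<close>, since there the model is constant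
  to first order.  All uniform estimates are thereby reduced to the unit ball.\<close>

lemma dented_local_model:
  fixes k0 :: "'k::finite" and \<iota> :: "'k \<Rightarrow> 'm::finite"
  assumes "\<epsilon> > 0" "finite I" and "\<And>v w. v \<in> I \<Longrightarrow> w \<in> I \<Longrightarrow> v \<noteq> w \<Longrightarrow> dist (p v) (p w) \<ge> 2 * \<epsilon>"
  obtains z where "norm z \<le> 1" "dented k0 \<iota> \<epsilon> I p y = \<epsilon> *\<^sub>R (axis k0 1 + dent k0 \<iota> z)"
    "dented_deriv k0 \<iota> \<epsilon> I p y = dent_deriv k0 \<iota> z"
proof (cases "\<exists>v\<in>I. dist (p v) y < \<epsilon>")
  case True
  then obtain v where v: "v \<in> I" "dist (p v) y < \<epsilon>" by auto
  have "norm ((y - p v) /\<^sub>R \<epsilon>) \<le> 1"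
    using assms(1) v by (simp add: norm_rescaled del: norm_scaleR)
  then show ?thesis
    using that dented_in_ball[of \<epsilon> I p, OF assms v] by blast
next
  case False
  have "norm (axis (\<iota> k0) 1 :: real^'m) = 1" by (simp add: norm_axis_1)
  then show ?thesis
    using that[of "axis (\<iota> k0) 1"] dented_outside[of \<epsilon> I p y k0 \<iota>] False assms(1)
      dent_outside[of "axis (\<iota> k0) 1" k0 \<iota>] by (auto simp: not_less)
qed

section \<open>Tangent vectors and differentials in charts\<close>

locale riemannian_manifold =
  fixes M :: "'a topology" and A :: "('a, 'm::finite) chart set" and g :: "('a, 'm) metric_tensor"
  assumes manifold: "smooth_manifold M A" and metric: "riemannian_metric M A g"
begin

lemma Hausdorff: "Hausdorff_space M"
  using manifold by (simp add: smooth_manifold_def)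

lemma chart_at: "x \<in> topspace M \<Longrightarrow> \<exists>c\<in>A. x \<in> fst c"
  using manifold by (auto simp: smooth_manifold_def)

context
  fixes c assumes c: "c \<in> A"
begin

lemma openin_chart: "openin M (fst c)"
  using manifold c by (simp add: smooth_manifold_def)

lemma chart_subset: "fst c \<subseteq> topspace M"
  using openin_chart by (rule openin_subset)

lemma open_chart_image: "open (snd c ` fst c)"
  using manifold c by (simp add: smooth_manifold_def)

lemma chart_homeo: "homeomorphic_map (subtopology M (fst c)) (top_of_set (snd c ` fst c)) (snd c)"
  using manifold c by (simp add: smooth_manifold_def)

lemma topspace_chart: "topspace (subtopology M (fst c)) = fst c"
  using chart_subset by auto

lemma chart_inj: "inj_on (snd c) (fst c)"
  using homeomorphic_imp_injective_map[OF chart_homeo] topspace_chart by simp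

lemma chart_inv_chart [simp]: "x \<in> fst c \<Longrightarrow> chart_inv c (snd c x) = x"
  using chart_inj by (rule inv_into_f_f)

lemma open_image_openin:
  assumes "openin M U" "U \<subseteq> fst c"
  shows "open (snd c ` U)"
proof -
  have "openin (subtopology M (fst c)) U"
    using assms by (metis openin_subset_topspace_eq openin_subtopology inf.absorb1)
  then have "openin (top_of_set (snd c ` fst c)) (snd c ` U)"
    using homeomorphic_imp_open_map[OF chart_homeo] by (auto simp: open_map_def)
  then show ?thesis using open_chart_image by (rule openin_open_trans)
qed

lemma openin_chart_vimage:
  assumes "open V"
  shows "openin M {x \<in> fst c. snd c x \<in> V}"
proof -
  have "continuous_map (subtopology M (fst c)) euclidean (snd c)"
    using homeomorphic_imp_continuous_map[OF chart_homeo] by (simp add: continuous_map_in_subtopology)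
  then have "openin (subtopology M (fst c)) {x \<in> topspace (subtopology M (fst c)). snd c x \<in> V}"
    using assms openin_continuous_map_preimage by fastforce
  then show ?thesis
    unfolding topspace_chart using openin_chart by (rule openin_trans_full)
qed

lemma compactin_chart_vimage:
  assumes "compact K" "K \<subseteq> snd c ` fst c"
  shows "compactin M {x \<in> fst c. snd c x \<in> K}"
proof -
  let ?U = "{x \<in> fst c. snd c x \<in> K}"
  have "snd c ` ?U = K" using assms(2) by auto
  then have "compactin (top_of_set (snd c ` fst c)) (snd c ` ?U)"
    using assms by (simp add: compactin_subtopology)
  then have "compactin (subtopology M (fst c)) ?U"
    using homeomorphic_map_compactness[OF chart_homeo, of ?U] topspace_chart by auto
  then show ?thesis by (simp add: compactin_subtopology)
qed

end

lemma transition_C1: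
  assumes "c \<in> A" "d \<in> A"
  shows "Cn_on 1 (snd c ` (fst c \<inter> fst d)) (snd d \<circ> chart_inv c)"
  using manifold assms unfolding smooth_manifold_def smooth_on_def by blast

lemma open_overlap: "c \<in> A \<Longrightarrow> d \<in> A \<Longrightarrow> open (snd c ` (fst c \<inter> fst d))"
  by (intro open_image_openin openin_Int openin_chart) auto

abbreviation transition_deriv :: "('a, 'm) chart \<Rightarrow> ('a, 'm) chart \<Rightarrow> 'a \<Rightarrow> real^'m \<Rightarrow> real^'m" where
  "transition_deriv c d x \<equiv> frechet_derivative (snd d \<circ> chart_inv c) (at (snd c x))"

lemma transition_deriv:
  assumes "c \<in> A" "d \<in> A" "x \<in> fst c" "x \<in> fst d"
  shows "((snd d \<circ> chart_inv c) has_derivative transition_deriv c d x) (at (snd c x))"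
  using Cn_on_1D[OF transition_C1[OF assms(1,2)], of "snd c x"] assms by auto

text \<open>The chain rule for the representatives of \<open>f\<close> in two charts.  For \<open>f = snd e\<close> it is the
  cocycle property of the transition maps.\<close>

lemma has_derivative_change_chart:
  assumes "c \<in> A" "d \<in> A" "x \<in> fst c" "x \<in> fst d"
    and f: "((f \<circ> chart_inv d) has_derivative D) (at (snd d x))"
  shows "((f \<circ> chart_inv c) has_derivative (\<lambda>u. D (transition_deriv c d x u))) (at (snd c x))"
proof -
  have f: "((f \<circ> chart_inv d) has_derivative D) (at ((snd d \<circ> chart_inv c) (snd c x)))"
    using f assms by simp
  have "(((f \<circ> chart_inv d) \<circ> (snd d \<circ> chart_inv c)) has_derivative (\<lambda>u. D (transition_deriv c d x u))) (at (snd c x))"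
    using diff_chain_at[OF transition_deriv[OF assms(1-4)] f] by (simp add: o_def)
  then show ?thesis
    by (rule has_derivative_transform_within_open[OF _ open_overlap[OF assms(1,2)]])
      (use assms in auto)
qed

lemma transition_deriv_self:
  assumes "c \<in> A" "x \<in> fst c"
  shows "transition_deriv c c x = (\<lambda>u. u)"
proof -
  have "((\<lambda>y. y) has_derivative (\<lambda>u. u)) (at (snd c x))" by simp
  then have "((snd c \<circ> chart_inv c) has_derivative (\<lambda>u. u)) (at (snd c x))"
    by (rule has_derivative_transform_within_open[OF _ open_chart_image[OF assms(1)]]) (use assms in auto)
  then show ?thesis using frechet_derivative_at by metis
qed

lemma transition_deriv_compose:
  assumes "c \<in> A" "d \<in> A" "e \<in> A" "x \<in> fst c" "x \<in> fst d" "x \<in> fst e"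
  shows "transition_deriv c e x u = transition_deriv d e x (transition_deriv c d x u)"
proof -
  have "((snd e \<circ> chart_inv c) has_derivative (\<lambda>u. transition_deriv d e x (transition_deriv c d x u))) (at (snd c x))"
    using assms by (intro has_derivative_change_chart transition_deriv)
  from frechet_derivative_at[OF this] show ?thesis by metis
qed

lemma coord_vector_self [simp]:
  "c \<in> A \<Longrightarrow> x \<in> fst c \<Longrightarrow> coord_vector A c x u c = u"
  by (simp add: coord_vector_def transition_deriv_self)

lemma coord_vector_in_tangent_space:
  assumes "c \<in> A" "x \<in> fst c"
  shows "coord_vector A c x u \<in> tangent_space A x"
  unfolding tangent_space_def mem_Collect_eq
proof (intro conjI ballI allI impI)
  fix d e assume "d \<in> A" "e \<in> A" "x \<in> fst d \<and> x \<in> fst e"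
  then show "coord_vector A c x u e = frechet_derivative (snd e \<circ> chart_inv d) (at (snd d x)) (coord_vector A c x u d)"
    using transition_deriv_compose[of c d e x u] assms by (simp only: coord_vector_def) simp
qed (simp only: coord_vector_def if_False)

lemma tangent_vector_eq_coord_vector:
  assumes "c \<in> A" "x \<in> fst c" "v \<in> tangent_space A x"
  shows "v = coord_vector A c x (v c)"
proof
  fix d
  have 1: "v d = frechet_derivative (snd d \<circ> chart_inv c) (at (snd c x)) (v c)" if "d \<in> A" "x \<in> fst d"
    using assms that unfolding tangent_space_def by blast
  have 2: "v d = 0" if "\<not> (d \<in> A \<and> x \<in> fst d)"
    using assms(3) that unfolding tangent_space_def by blast
  show "v d = coord_vector A c x (v c) d"
    unfolding coord_vector_def using 1 2 by auto
qed

text \<open>A chart around \<open>x\<close> identifies the tangent space with \<open>\<real>\<^sup>m\<close>, so that everything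
  below can be computed in one conveniently chosen chart.\<close>

lemma tangent_space_eq:
  assumes "c \<in> A" "x \<in> fst c"
  shows "tangent_space A x = range (coord_vector A c x)"
proof
  show "tangent_space A x \<subseteq> range (coord_vector A c x)"
    using tangent_vector_eq_coord_vector[OF assms] by (intro subsetI) (rule range_eqI)
  show "range (coord_vector A c x) \<subseteq> tangent_space A x"
    using coord_vector_in_tangent_space[OF assms] by (rule image_subsetI)
qed

lemma coord_vector_linear:
  assumes "c \<in> A" "x \<in> fst c"
  shows "coord_vector A c x (a *\<^sub>R u + b *\<^sub>R w) = (\<lambda>d. a *\<^sub>R coord_vector A c x u d + b *\<^sub>R coord_vector A c x w d)"
proof
  fix d
  show "coord_vector A c x (a *\<^sub>R u + b *\<^sub>R w) d = a *\<^sub>R coord_vector A c x u d + b *\<^sub>R coord_vector A c x w d"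
  proof (cases "d \<in> A \<and> x \<in> fst d")
    case True
    then have "linear (transition_deriv c d x)"
      using has_derivative_linear[OF transition_deriv[OF assms(1) _ assms(2)]] by blast
    from linear_add[OF this, of "a *\<^sub>R u" "b *\<^sub>R w"] linear_scale[OF this, of a u] linear_scale[OF this, of b w]
    show ?thesis using True by (simp add: coord_vector_def)
  next
    case False
    then show ?thesis by (simp only: coord_vector_def if_False scaleR_zero_right add_0_right)
  qed
qed

lemma C1_maps_has_derivative:
  assumes "f \<in> C1_maps A" "c \<in> A" "x \<in> fst c"
  shows "((f \<circ> chart_inv c) has_derivative frechet_derivative (f \<circ> chart_inv c) (at (snd c x))) (at (snd c x))"
  using Cn_on_1D[of "snd c ` fst c" "f \<circ> chart_inv c" "snd c x"] assms by (auto simp: C1_maps_def)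

text \<open>The definition of \<open>differential\<close> picks an unspecified chart; the chain rule shows that any
  chart gives the same value.\<close>

lemma differential_coord_vector:
  assumes f: "f \<in> C1_maps A" and c: "c \<in> A" "x \<in> fst c"
  shows "differential A f x (coord_vector A c x u) = frechet_derivative (f \<circ> chart_inv c) (at (snd c x)) u"
proof -
  define d where "d = (SOME c. c \<in> A \<and> x \<in> fst c)"
  have d: "d \<in> A \<and> x \<in> fst d" unfolding d_def by (rule someI[of _ c]) (use c in simp)
  have "differential A f x (coord_vector A c x u) = frechet_derivative (f \<circ> chart_inv d) (at (snd d x)) (transition_deriv c d x u)"
    using d by (simp add: differential_def d_def[symmetric] coord_vector_def)
  also have "\<dots> = frechet_derivative (f \<circ> chart_inv c) (at (snd c x)) u"
    using fun_cong[OF frechet_derivative_at[OF has_derivative_change_chart[OF c(1) _ c(2) _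
          C1_maps_has_derivative[OF f, of d x]]], of u] d
    by simp
  finally show ?thesis .
qed

lemma C1_maps_diff:
  assumes "f \<in> C1_maps A" "h \<in> C1_maps A"
  shows "(\<lambda>x. f x - h x) \<in> C1_maps A"
  unfolding C1_maps_def mem_Collect_eq o_def
  using assms by (intro ballI Cn_on_1_diff) (simp_all add: C1_maps_def o_def)

lemma C1_maps_const: "(\<lambda>x. k) \<in> C1_maps A"
  by (auto simp: C1_maps_def o_def intro: Cn_on_1_const)

lemma differential_diff:
  assumes "f \<in> C1_maps A" "h \<in> C1_maps A" "c \<in> A" "x \<in> fst c"
  shows "differential A (\<lambda>x. f x - h x) x (coord_vector A c x u)
    = differential A f x (coord_vector A c x u) - differential A h x (coord_vector A c x u)"
proof -
  let ?D = "\<lambda>f. frechet_derivative (f \<circ> chart_inv c) (at (snd c x))"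
  have "((\<lambda>y. (f \<circ> chart_inv c) y - (h \<circ> chart_inv c) y) has_derivative (\<lambda>u. ?D f u - ?D h u)) (at (snd c x))"
    using assms by (intro has_derivative_diff C1_maps_has_derivative)
  then have "(((\<lambda>x. f x - h x) \<circ> chart_inv c) has_derivative (\<lambda>u. ?D f u - ?D h u)) (at (snd c x))"
    by (simp add: o_def)
  from fun_cong[OF frechet_derivative_at[OF this], of u]
  have "?D (\<lambda>x. f x - h x) u = ?D f u - ?D h u" ..
  then show ?thesis
    unfolding differential_coord_vector[OF assms(1,3,4)] differential_coord_vector[OF assms(2,3,4)]
      differential_coord_vector[OF C1_maps_diff[OF assms(1,2)] assms(3,4)] .
qed

lemma differential_linear:
  assumes "f \<in> C1_maps A" "c \<in> A" "x \<in> fst c"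
  shows "linear (\<lambda>u. differential A f x (coord_vector A c x u))"
  unfolding differential_coord_vector[OF assms]
  using has_derivative_linear[OF C1_maps_has_derivative[OF assms]] .

section \<open>The metric in coordinates\<close>

context
  fixes c x assumes cx: "c \<in> A" "x \<in> fst c"
begin

lemma metric_sym: "g x (coord_vector A c x u) (coord_vector A c x w) = g x (coord_vector A c x w) (coord_vector A c x u)"
  using metric cx chart_subset coord_vector_in_tangent_space[OF cx] unfolding riemannian_metric_def by blast

lemma metric_linear_left: "linear (\<lambda>u. g x (coord_vector A c x u) (coord_vector A c x w))"
proof -
  have xM: "x \<in> topspace M" using cx chart_subset by blast
  have "g x (coord_vector A c x (a *\<^sub>R u + b *\<^sub>R u')) (coord_vector A c x w)
    = a * g x (coord_vector A c x u) (coord_vector A c x w) + b * g x (coord_vector A c x u') (coord_vector A c x w)" for a b u u'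
    unfolding coord_vector_linear[OF cx]
    using metric xM coord_vector_in_tangent_space[OF cx] unfolding riemannian_metric_def by blast
  from this[of 1 _ 1] this[of _ _ 0] show ?thesis
    by (intro linearI) auto
qed

lemma metric_linear_right: "linear (\<lambda>w. g x (coord_vector A c x u) (coord_vector A c x w))"
  using metric_linear_left[of u] by (subst metric_sym)

lemma metric_expand:
  "g x (coord_vector A c x u) (coord_vector A c x u)
    = (\<Sum>b\<in>Basis. (u \<bullet> b) * (\<Sum>b'\<in>Basis. (u \<bullet> b') * g x (coord_vector A c x b) (coord_vector A c x b')))"
  by (subst linear_sum_Basis[OF metric_linear_left, of u], subst linear_sum_Basis[OF metric_linear_right, of _ u]) simp

lemma metric_scale:
  "g x (coord_vector A c x (t *\<^sub>R u)) (coord_vector A c x (t *\<^sub>R u)) = t\<^sup>2 * g x (coord_vector A c x u) (coord_vector A c x u)"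
  by (simp add: linear_scale[OF metric_linear_left] linear_scale[OF metric_linear_right] power2_eq_square)

lemma metric_pos:
  assumes "u \<noteq> 0"
  shows "g x (coord_vector A c x u) (coord_vector A c x u) > 0"
proof -
  have "coord_vector A c x u \<noteq> (\<lambda>c. 0)"
    using assms coord_vector_self[OF cx] by metis
  then show ?thesis
    using metric cx chart_subset coord_vector_in_tangent_space[OF cx] unfolding riemannian_metric_def by blast
qed

end

definition metric_norm :: "('a, 'm) chart \<Rightarrow> 'a \<Rightarrow> real^'m \<Rightarrow> real" where
  "metric_norm c x u = sqrt (g x (coord_vector A c x u) (coord_vector A c x u))"

lemma metric_norm_scale:
  assumes "c \<in> A" "x \<in> fst c"
  shows "metric_norm c x (t *\<^sub>R u) = \<bar>t\<bar> * metric_norm c x u"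
  by (simp add: metric_norm_def metric_scale[OF assms] real_sqrt_mult)

lemma metric_norm_pos: "c \<in> A \<Longrightarrow> x \<in> fst c \<Longrightarrow> u \<noteq> 0 \<Longrightarrow> metric_norm c x u > 0"
  by (simp add: metric_norm_def metric_pos)

lemma metric_norm_nonneg: "c \<in> A \<Longrightarrow> x \<in> fst c \<Longrightarrow> metric_norm c x u \<ge> 0"
  using metric_norm_pos[of c x u] metric_norm_scale[of c x 0 u] by (cases "u = 0") auto

text \<open>The length is a continuous positive function on the compact product of \<open>K\<close> with the unit
  sphere, hence lies between two positive constants there; homogeneity extends this to all \<open>u\<close>.\<close>

lemma metric_norm_bounds:
  assumes c: "c \<in> A" and K: "compact K" "K \<subseteq> snd c ` fst c"
  obtains a b where "a > 0" "b > 0"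
    "\<And>x u. x \<in> fst c \<Longrightarrow> snd c x \<in> K \<Longrightarrow> a * norm u \<le> metric_norm c x u \<and> metric_norm c x u \<le> b * norm u"
proof (cases "K = {}")
  case True
  then show ?thesis using that[of 1 1] by simp
next
  case False
  let ?K = "K \<times> sphere 0 1 :: ((real^'m) \<times> (real^'m)) set"
  let ?h = "\<lambda>p. metric_norm c (chart_inv c (fst p)) (snd p)"
  have eq: "?h (y, u) = sqrt (\<Sum>b\<in>Basis. (u \<bullet> b) * (\<Sum>b'\<in>Basis. (u \<bullet> b') *
      g (chart_inv c y) (coord_vector A c (chart_inv c y) b) (coord_vector A c (chart_inv c y) b')))"
    if "y \<in> K" for y u
  proof -
    have "chart_inv c y \<in> fst c" using that K c by auto
    then show ?thesis by (simp add: metric_norm_def metric_expand[OF c])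
  qed
  have cg: "continuous_on (snd c ` fst c) (\<lambda>y. g (chart_inv c y) (coord_vector A c (chart_inv c y) b) (coord_vector A c (chart_inv c y) b'))" for b b'
  proof -
    have "smooth_on (snd c ` fst c) (\<lambda>y. g (chart_inv c y) (coord_vector A c (chart_inv c y) b) (coord_vector A c (chart_inv c y) b'))"
      using metric c unfolding riemannian_metric_def Let_def by blast
    then have "Cn_on 0 (snd c ` fst c) (\<lambda>y. g (chart_inv c y) (coord_vector A c (chart_inv c y) b) (coord_vector A c (chart_inv c y) b'))"
      unfolding smooth_on_def by blast
    then show ?thesis by simp
  qed
  have "continuous_on ?K (\<lambda>p. sqrt (\<Sum>b\<in>Basis. (snd p \<bullet> b) * (\<Sum>b'\<in>Basis. (snd p \<bullet> b') *
      g (chart_inv c (fst p)) (coord_vector A c (chart_inv c (fst p)) b) (coord_vector A c (chart_inv c (fst p)) b'))))"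
    by (intro continuous_intros continuous_on_compose2[OF cg]) (use K in auto)
  then have cont: "continuous_on ?K ?h"
    by (rule continuous_on_eq) (use eq in auto)
  have "axis undefined 1 \<in> sphere (0::real^'m) 1" by (simp add: norm_axis_1)
  then have ne: "?K \<noteq> {}" using False by blast
  have cK: "compact ?K" by (intro compact_Times K compact_sphere)
  obtain p where p: "p \<in> ?K" "\<And>q. q \<in> ?K \<Longrightarrow> ?h p \<le> ?h q"
    using continuous_attains_inf[OF cK ne cont] by blast
  obtain r where r: "r \<in> ?K" "\<And>q. q \<in> ?K \<Longrightarrow> ?h q \<le> ?h r"
    using continuous_attains_sup[OF cK ne cont] by blast
  have pos: "?h q > 0" if "q \<in> ?K" for q
    using that K by (intro metric_norm_pos[OF c]) (auto simp: mem_Times_iff c)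
  show ?thesis
  proof (rule that[OF pos[OF p(1)] pos[OF r(1)]])
    fix x u assume x: "x \<in> fst c" "snd c x \<in> K"
    show "?h p * norm u \<le> metric_norm c x u \<and> metric_norm c x u \<le> ?h r * norm u"
    proof (cases "u = 0")
      case True
      then show ?thesis using metric_norm_scale[OF c x(1), of 0 u] by simp
    next
      case False
      let ?q = "(snd c x, u /\<^sub>R norm u)"
      have q: "?q \<in> ?K" using x False by simp
      have "?h ?q * norm u = metric_norm c x (norm u *\<^sub>R (u /\<^sub>R norm u))"
        using x c by (subst metric_norm_scale) auto
      then have e: "?h ?q * norm u = metric_norm c x u" using False by simp
      show ?thesis using p(2)[OF q] r(2)[OF q] e by (metis mult_right_mono norm_ge_zero)
    qed
  qed
qed

lemma C1_bounded_on_chart_compact: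
  assumes f: "f \<in> C1_maps A" and c: "c \<in> A" and K: "compact K" "K \<subseteq> snd c ` fst c"
  obtains C where "\<And>x. x \<in> fst c \<Longrightarrow> snd c x \<in> K \<Longrightarrow> norm (f x) \<le> C"
    "\<And>x u. x \<in> fst c \<Longrightarrow> snd c x \<in> K \<Longrightarrow> norm (differential A f x (coord_vector A c x u)) \<le> C * norm u"
proof -
  let ?f = "f \<circ> chart_inv c"
  let ?N = "\<lambda>y. norm (?f y) + (\<Sum>b\<in>Basis. norm (frechet_derivative ?f (at y) b))"
  have C1: "Cn_on 1 (snd c ` fst c) ?f" using f c by (simp add: C1_maps_def)
  have "continuous_on (snd c ` fst c) ?N"
    by (intro continuous_intros Cn_on_1_continuous_deriv[OF C1] Cn_on_1_imp_continuous_on[OF C1])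
  then have "compact (?N ` K)" using K by (intro compact_continuous_image) (auto intro: continuous_on_subset)
  from compact_imp_bounded[OF this] obtain C where "\<forall>t\<in>?N ` K. norm t \<le> C"
    unfolding bounded_iff by (rule exE)
  then have C: "?N y \<le> C" if "y \<in> K" for y
    using that by (auto intro: order_trans[OF abs_ge_self])
  show ?thesis
  proof (rule that[of C])
    fix x assume x: "x \<in> fst c" "snd c x \<in> K"
    have N: "norm (f x) + (\<Sum>b\<in>Basis. norm (frechet_derivative ?f (at (snd c x)) b)) \<le> C"
      using C[OF x(2)] x c by simp
    moreover have "(\<Sum>b\<in>Basis. norm (frechet_derivative ?f (at (snd c x)) b)) \<ge> 0" by (intro sum_nonneg) auto
    ultimately show "norm (f x) \<le> C" by linarith
    fix u
    have "norm (differential A f x (coord_vector A c x u))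
        = norm (\<Sum>b\<in>Basis. (u \<bullet> b) *\<^sub>R frechet_derivative ?f (at (snd c x)) b)"
      unfolding differential_coord_vector[OF f c x(1)]
      using linear_sum_Basis[OF has_derivative_linear[OF C1_maps_has_derivative[OF f c x(1)]], of u] by simp
    also have "\<dots> \<le> (\<Sum>b\<in>Basis. norm u * norm (frechet_derivative ?f (at (snd c x)) b))"
      by (intro sum_norm_le) (simp add: Basis_le_norm mult_right_mono)
    also have "\<dots> \<le> norm u * C"
      unfolding sum_distrib_left[symmetric] using N by (intro mult_left_mono) (auto intro: order_trans[rotated])
    finally show "norm (differential A f x (coord_vector A c x u)) \<le> C * norm u"
      by (simp add: mult.commute)
  qed
qed

lemma C1_map_locally_bounded:
  assumes f: "f \<in> C1_maps A" and x: "x \<in> topspace M"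
  shows "\<exists>U C. openin M U \<and> x \<in> U \<and> (\<forall>x\<in>U. norm (f x) \<le> C \<and>
     (\<forall>v\<in>tangent_space A x. norm (differential A f x v) \<le> C * sqrt (g x v v)))"
proof -
  obtain c where c: "c \<in> A" "x \<in> fst c" using chart_at[OF x] by blast
  obtain r where r: "r > 0" "cball (snd c x) r \<subseteq> snd c ` fst c"
    using open_chart_image[OF c(1)] c(2) open_contains_cball by blast
  let ?K = "cball (snd c x) r"
  obtain a b where ab: "a > 0" "\<And>x u. x \<in> fst c \<Longrightarrow> snd c x \<in> ?K \<Longrightarrow> a * norm u \<le> metric_norm c x u"
    using metric_norm_bounds[OF c(1) compact_cball r(2)] by metis
  obtain C where C: "\<And>x. x \<in> fst c \<Longrightarrow> snd c x \<in> ?K \<Longrightarrow> norm (f x) \<le> C"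
    "\<And>x u. x \<in> fst c \<Longrightarrow> snd c x \<in> ?K \<Longrightarrow> norm (differential A f x (coord_vector A c x u)) \<le> C * norm u"
    using C1_bounded_on_chart_compact[OF f c(1) compact_cball r(2)] by metis
  have C0: "C \<ge> 0" using C(1)[OF c(2)] r(1) order_trans[OF norm_ge_zero] by simp
  let ?U = "{x' \<in> fst c. snd c x' \<in> ball (snd c x) r}"
  let ?B = "max C (C / a)"
  have "norm (f x') \<le> ?B \<and> (\<forall>v\<in>tangent_space A x'. norm (differential A f x' v) \<le> ?B * sqrt (g x' v v))"
    if "x' \<in> ?U" for x'
  proof (intro conjI ballI)
    have x': "x' \<in> fst c" "snd c x' \<in> ?K" using that by auto
    show "norm (f x') \<le> ?B" using C(1)[OF x'] by simp
    fix v assume "v \<in> tangent_space A x'"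
    then obtain u where v: "v = coord_vector A c x' u"
      using tangent_space_eq[OF c(1) x'(1)] by blast
    have "norm (differential A f x' v) \<le> C * norm u" unfolding v using C(2)[OF x'] .
    also have "\<dots> \<le> C * (metric_norm c x' u / a)"
      using ab(1) ab(2)[OF x', of u] C0 by (intro mult_left_mono) (simp_all add: field_simps)
    also have "\<dots> \<le> ?B * metric_norm c x' u"
      using mult_right_mono[OF max.cobounded2[of "C / a" C] metric_norm_nonneg[OF c(1) x'(1), of u]] by simp
    finally show "norm (differential A f x' v) \<le> ?B * sqrt (g x' v v)"
      by (simp add: v metric_norm_def)
  qed
  moreover have "openin M ?U" by (rule openin_chart_vimage[OF c(1) open_ball])
  moreover have "x \<in> ?U" using c r by simp
  ultimately show ?thesis by blast
qed

end

section \<open>The \<open>C\<^sup>1\<close> norm on a compact manifold\<close>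

locale compact_riemannian_manifold = riemannian_manifold M A g
  for M :: "'a topology" and A :: "('a, 'm::finite) chart set" and g +
  assumes compact: "compact_space M" and nonempty: "topspace M \<noteq> {}"
begin

text \<open>The local bounds are joined along a finite subcover.  Without this finiteness the supremum in
  \<open>C1_norm\<close> would be an unspecified number.\<close>

lemma C1_map_bounded:
  assumes f: "f \<in> C1_maps A"
  shows "\<exists>C. \<forall>x\<in>topspace M. norm (f x) \<le> C \<and>
    (\<forall>v\<in>tangent_space A x. norm (differential A f x v) \<le> C * sqrt (g x v v))"
proof -
  define Q where "Q C x \<longleftrightarrow> norm (f x) \<le> C \<and>
     (\<forall>v\<in>tangent_space A x. norm (differential A f x v) \<le> C * sqrt (g x v v))" for C x
  define P where "P U \<longleftrightarrow> (\<exists>C. \<forall>x\<in>U \<inter> topspace M. Q C x)" for U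
  have pos: "g x v v \<ge> 0" if xv: "x \<in> topspace M" "v \<in> tangent_space A x" for x v
  proof -
    obtain c where c: "c \<in> A" "x \<in> fst c" using chart_at[OF xv(1)] by blast
    then obtain u where "v = coord_vector A c x u" using xv(2) tangent_space_eq by blast
    then show ?thesis using metric_norm_nonneg[OF c, of u] by (simp add: metric_norm_def)
  qed
  have mono: "Q D x" if QC: "Q C x" and CD: "C \<le> D" and x: "x \<in> topspace M" for C D x
    unfolding Q_def
  proof (intro conjI ballI)
    show "norm (f x) \<le> D" using QC CD unfolding Q_def by linarith
    fix v assume v: "v \<in> tangent_space A x"
    then have "norm (differential A f x v) \<le> C * sqrt (g x v v)" using QC unfolding Q_def by blast
    also have "\<dots> \<le> D * sqrt (g x v v)" using CD pos[OF x v] by (simp add: mult_right_mono)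
    finally show "norm (differential A f x v) \<le> D * sqrt (g x v v)" .
  qed
  have Un: "P (U \<union> V)" if UV: "P U" "P V" for U V
  proof -
    obtain C D where C: "\<forall>x\<in>U \<inter> topspace M. Q C x" and D: "\<forall>x\<in>V \<inter> topspace M. Q D x"
      using UV unfolding P_def by blast
    have "Q (max C D) x" if "x \<in> (U \<union> V) \<inter> topspace M" for x
      using C D that mono[of C x "max C D"] mono[of D x "max C D"] by auto
    then show ?thesis unfolding P_def by blast
  qed
  define \<U> where "\<U> = {U. openin M U \<and> P U}"
  have "topspace M \<subseteq> \<Union>\<U>"
  proof
    fix x assume "x \<in> topspace M"
    from C1_map_locally_bounded[OF f this] obtain U C where "openin M U" "x \<in> U" "\<forall>x\<in>U. Q C x"
      unfolding Q_def by blast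
    then show "x \<in> \<Union>\<U>"
      unfolding \<U>_def P_def by blast
  qed
  moreover have "\<forall>U\<in>\<U>. openin M U" by (simp add: \<U>_def)
  ultimately obtain \<F> where F: "finite \<F>" "\<F> \<subseteq> \<U>" "topspace M \<subseteq> \<Union>\<F>"
    using compact unfolding compact_space_alt by meson
  have "P (\<Union>\<F>)" using F(1,2)
  proof (induction \<F> rule: finite_induct)
    case empty
    show ?case by (simp add: P_def)
  next
    case (insert U \<F>)
    then show ?case using Un by (simp add: \<U>_def)
  qed
  then obtain C where "\<forall>x\<in>\<Union>\<F> \<inter> topspace M. Q C x"
    unfolding P_def by (rule exE)
  then show ?thesis using F(3) unfolding Q_def by blast
qed

lemma unit_tangent_vector:
  assumes "c \<in> A" "x \<in> fst c" "u \<noteq> 0"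
  shows "sqrt (g x (coord_vector A c x (u /\<^sub>R metric_norm c x u)) (coord_vector A c x (u /\<^sub>R metric_norm c x u))) = 1"
  using metric_norm_scale[OF assms(1,2), of "inverse (metric_norm c x u)" u] metric_norm_pos[OF assms]
  by (simp add: metric_norm_def[symmetric])

lemma unit_differentials_nonempty:
  assumes "x \<in> topspace M"
  shows "{norm (differential A f x v) | v. v \<in> tangent_space A x \<and> sqrt (g x v v) = 1} \<noteq> {}"
proof -
  obtain c where c: "c \<in> A" "x \<in> fst c" using chart_at[OF assms] by blast
  have "axis undefined 1 \<noteq> (0::real^'m)" by (simp add: axis_eq_0_iff)
  then show ?thesis
    using unit_tangent_vector[OF c] coord_vector_in_tangent_space[OF c] by blast
qed

lemma C1_norm_le:
  assumes "\<And>x. x \<in> topspace M \<Longrightarrow> norm (f x) \<le> a"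
    and "\<And>x v. x \<in> topspace M \<Longrightarrow> v \<in> tangent_space A x \<Longrightarrow> norm (differential A f x v) \<le> b * sqrt (g x v v)"
  shows "C1_norm M A g f \<le> a + b"
  unfolding C1_norm_def
proof (intro cSUP_least nonempty add_mono assms(1))
  fix x assume x: "x \<in> topspace M"
  show "differential_norm A g f x \<le> b"
    unfolding differential_norm_def
  proof (rule cSup_least[OF unit_differentials_nonempty[OF x]])
    fix t assume "t \<in> {norm (differential A f x v) | v. v \<in> tangent_space A x \<and> sqrt (g x v v) = 1}"
    then obtain v where "t = norm (differential A f x v)" "v \<in> tangent_space A x" "sqrt (g x v v) = 1" by blast
    then show "t \<le> b" using assms(2)[OF x, of v] by simp
  qed
qed

context
  fixes f assumes f: "f \<in> C1_maps A"
begin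

lemma differential_norm_upper:
  assumes "x \<in> topspace M" "v \<in> tangent_space A x" "sqrt (g x v v) = 1"
  shows "norm (differential A f x v) \<le> differential_norm A g f x"
proof -
  obtain C where C: "\<forall>x\<in>topspace M. norm (f x) \<le> C \<and>
      (\<forall>v\<in>tangent_space A x. norm (differential A f x v) \<le> C * sqrt (g x v v))"
    using C1_map_bounded[OF f] by (rule exE)
  have "t \<le> C" if "t \<in> {norm (differential A f x v) | v. v \<in> tangent_space A x \<and> sqrt (g x v v) = 1}" for t
  proof -
    from that obtain v where "t = norm (differential A f x v)" "v \<in> tangent_space A x" "sqrt (g x v v) = 1" by blast
    then show ?thesis using C assms(1) by (metis mult.right_neutral)
  qed
  then have "bdd_above {norm (differential A f x v) | v. v \<in> tangent_space A x \<and> sqrt (g x v v) = 1}"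
    by (rule bdd_aboveI)
  then show ?thesis
    unfolding differential_norm_def using assms by (intro cSup_upper) auto
qed

lemma differential_norm_nonneg:
  assumes "x \<in> topspace M"
  shows "differential_norm A g f x \<ge> 0"
proof -
  obtain v where "v \<in> tangent_space A x" "sqrt (g x v v) = 1"
    using unit_differentials_nonempty[OF assms, of f] by blast
  then have "norm (differential A f x v) \<le> differential_norm A g f x"
    by (rule differential_norm_upper[OF assms])
  then show ?thesis by (rule order_trans[OF norm_ge_zero])
qed

lemma C1_norm_upper:
  assumes x: "x \<in> topspace M"
  shows "norm (f x) + differential_norm A g f x \<le> C1_norm M A g f"
proof -
  obtain C where C: "\<forall>x\<in>topspace M. norm (f x) \<le> C \<and>
      (\<forall>v\<in>tangent_space A x. norm (differential A f x v) \<le> C * sqrt (g x v v))"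
    using C1_map_bounded[OF f] by (rule exE)
  have "norm (f x) + differential_norm A g f x \<le> C + C" if x: "x \<in> topspace M" for x
  proof (intro add_mono)
    show "norm (f x) \<le> C" using C x by blast
    show "differential_norm A g f x \<le> C"
      unfolding differential_norm_def
    proof (rule cSup_least[OF unit_differentials_nonempty[OF x]])
      fix t assume "t \<in> {norm (differential A f x v) | v. v \<in> tangent_space A x \<and> sqrt (g x v v) = 1}"
      then obtain v where "t = norm (differential A f x v)" "v \<in> tangent_space A x" "sqrt (g x v v) = 1" by blast
      then show "t \<le> C" using C x by (metis mult.right_neutral)
    qed
  qed
  then show ?thesis unfolding C1_norm_def using x
    by (intro cSUP_upper bdd_aboveI[of _ "C + C"]) auto
qed

lemma norm_le_C1_norm: "x \<in> topspace M \<Longrightarrow> norm (f x) \<le> C1_norm M A g f"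
  using C1_norm_upper[of x] differential_norm_nonneg[of x] by linarith

lemma C1_norm_nonneg: "C1_norm M A g f \<ge> 0"
proof -
  obtain x where "x \<in> topspace M" using nonempty by blast
  then show ?thesis using norm_le_C1_norm[of x] norm_ge_zero[of "f x"] by linarith
qed

lemma differential_le_C1_norm:
  assumes c: "c \<in> A" "x \<in> fst c"
  shows "norm (differential A f x (coord_vector A c x u)) \<le> C1_norm M A g f * metric_norm c x u"
proof (cases "u = 0")
  case True
  then show ?thesis
    using linear_0[OF differential_linear[OF f c]] mult_nonneg_nonneg[OF C1_norm_nonneg metric_norm_nonneg[OF c, of u]]
    by simp
next
  case False
  let ?s = "metric_norm c x u"
  have s: "?s > 0" using metric_norm_pos[OF c False] .
  have x: "x \<in> topspace M" using c chart_subset by blast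
  have "norm (differential A f x (coord_vector A c x (u /\<^sub>R ?s))) \<le> differential_norm A g f x"
    using unit_tangent_vector[OF c False] coord_vector_in_tangent_space[OF c]
    by (intro differential_norm_upper x)
  also have "\<dots> \<le> C1_norm M A g f" using C1_norm_upper[OF x] norm_ge_zero[of "f x"] by linarith
  finally show ?thesis
    using s linear_scale[OF differential_linear[OF f c], of "inverse ?s" u]
    by (simp add: field_simps)
qed

end

end

section \<open>Extending a map from a chart by a constant\<close>

context riemannian_manifold begin

definition chart_extend :: "('a, 'm) chart \<Rightarrow> (real^'m \<Rightarrow> real^'k) \<Rightarrow> real^'k \<Rightarrow> 'a \<Rightarrow> real^'k" where
  "chart_extend c F e x = (if x \<in> fst c then F (snd c x) else e)"

context
  fixes c :: "('a, 'm) chart" and K and F :: "real^'m \<Rightarrow> real^'k::finite" and F' and e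
  assumes c: "c \<in> A" and K: "compact K" "K \<subseteq> snd c ` fst c"
    and F': "\<And>y. (F has_derivative F' y) (at y)"
    and contF': "\<And>u. continuous_on UNIV (\<lambda>y. F' y u)"
    and out: "\<And>y. y \<notin> K \<Longrightarrow> F y = e"
begin

abbreviation (input) "outside_K \<equiv> \<lambda>d. snd d ` (fst d - {x \<in> fst c. snd c x \<in> K})"

lemma open_outside_K:
  assumes "d \<in> A"
  shows "open (outside_K d)"
proof (rule open_image_openin[OF assms])
  have "closedin M {x \<in> fst c. snd c x \<in> K}"
    using Hausdorff compactin_chart_vimage[OF c K] by (rule compactin_imp_closedin)
  then show "openin M (fst d - {x \<in> fst c. snd c x \<in> K})"
    by (intro openin_diff openin_chart assms)
qed auto

lemma chart_extend_outside_K: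
  assumes "d \<in> A" "y \<in> outside_K d"
  shows "(chart_extend c F e \<circ> chart_inv d) y = e"
proof -
  obtain x where "y = snd d x" "x \<in> fst d" "\<not> (x \<in> fst c \<and> snd c x \<in> K)" using assms(2) by blast
  then show ?thesis using assms(1) out[of "snd c x"] by (auto simp: chart_extend_def)
qed

text \<open>Seen from another chart \<open>d\<close>, the extension is of class \<open>C\<^sup>1\<close> on two open sets that
  cover the chart: on the overlap with \<open>c\<close>, where it is \<open>F\<close> after a transition map, and off the
  preimage of \<open>K\<close>, where it is constant.  The second set is open because a compact subset
  of a Hausdorff space is closed.\<close>

lemma chart_extend_C1: "chart_extend c F e \<in> C1_maps A"
  unfolding C1_maps_def mem_Collect_eq
proof
  fix d assume d: "d \<in> A"
  let ?f = "chart_extend c F e \<circ> chart_inv d"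
  have "Cn_on 1 UNIV F" using F' contF' by (intro Cn_on_1I[of _ F F']) auto
  then have "Cn_on 1 (snd d ` (fst d \<inter> fst c)) (F \<circ> (snd c \<circ> chart_inv d))"
    by (rule Cn_on_1_compose[OF transition_C1[OF d c]]) simp
  then have 1: "Cn_on 1 (snd d ` (fst d \<inter> fst c)) ?f"
    by (rule Cn_on_1_cong[OF open_overlap[OF d c]]) (use d in \<open>auto simp: chart_extend_def\<close>)
  have 2: "Cn_on 1 (outside_K d) ?f"
    by (rule Cn_on_1_cong[OF open_outside_K[OF d] Cn_on_1_const[of _ e]])
      (rule chart_extend_outside_K[OF d, symmetric])
  have "snd d ` fst d = snd d ` (fst d \<inter> fst c) \<union> outside_K d" by auto
  then show "Cn_on 1 (snd d ` fst d) ?f"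
    using Cn_on_1_Un[OF open_overlap[OF d c] open_outside_K[OF d] 1 2] by simp
qed

lemma differential_chart_extend:
  assumes x: "x \<in> fst c"
  shows "differential A (chart_extend c F e) x (coord_vector A c x u) = F' (snd c x) u"
proof -
  have "((chart_extend c F e \<circ> chart_inv c) has_derivative F' (snd c x)) (at (snd c x))"
    by (rule has_derivative_transform_within_open[OF F' open_chart_image[OF c]])
      (use x c in \<open>auto simp: chart_extend_def\<close>)
  from fun_cong[OF frechet_derivative_at[OF this], of u] show ?thesis
    unfolding differential_coord_vector[OF chart_extend_C1 c x] by simp
qed

lemma differential_chart_extend_outside:
  assumes x: "x \<in> topspace M" "\<not> (x \<in> fst c \<and> snd c x \<in> K)" and v: "v \<in> tangent_space A x"
  shows "differential A (chart_extend c F e) x v = 0"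
proof -
  obtain d where d: "d \<in> A" "x \<in> fst d" using chart_at[OF x(1)] by blast
  obtain u where u: "v = coord_vector A d x u" using v unfolding tangent_space_eq[OF d] by blast
  have "((\<lambda>y. e) has_derivative (\<lambda>u. 0)) (at (snd d x))" by simp
  then have "((chart_extend c F e \<circ> chart_inv d) has_derivative (\<lambda>u. 0)) (at (snd d x))"
    by (rule has_derivative_transform_within_open[OF _ open_outside_K[OF d(1)]])
      (use x d in \<open>blast, simp only: chart_extend_outside_K[OF d(1)]\<close>)
  from fun_cong[OF frechet_derivative_at[OF this], of u] show ?thesis
    unfolding u differential_coord_vector[OF chart_extend_C1 d] by simp
qed

end

end

section \<open>Rank-deficient differentials\<close>

context riemannian_manifold begin

lemma differential_const:
  assumes "x \<in> topspace M" "v \<in> tangent_space A x"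
  shows "differential A (\<lambda>x. k) x v = 0"
proof -
  obtain d where d: "d \<in> A" "x \<in> fst d" using chart_at[OF assms(1)] by blast
  obtain u where u: "v = coord_vector A d x u" using assms(2) unfolding tangent_space_eq[OF d] by blast
  have "(((\<lambda>x. k) \<circ> chart_inv d) has_derivative (\<lambda>u. 0)) (at (snd d x))" by (simp add: o_def)
  from fun_cong[OF frechet_derivative_at[OF this], of u] show ?thesis
    unfolding u differential_coord_vector[OF C1_maps_const d] by simp
qed

text \<open>A proper subspace of \<open>\<real>\<^sup>k\<close> has a unit normal vector.\<close>

lemma differential_rank_deficient:
  fixes f :: "'a \<Rightarrow> real^'k::finite"
  assumes f: "f \<in> C1_maps A" and c: "c \<in> A" "x \<in> fst c" and rank: "differential_rank A f x < CARD('k)"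
  obtains \<mu> where "norm \<mu> = 1" "\<And>u. \<mu> \<bullet> differential A f x (coord_vector A c x u) = 0"
proof -
  let ?D = "\<lambda>u. differential A f x (coord_vector A c x u)"
  have "differential_rank A f x = dim (range ?D)"
    unfolding differential_rank_def tangent_space_eq[OF c] image_image ..
  then have "dim (range ?D) < DIM(real^'k)" using rank by simp
  then obtain \<mu> where \<mu>: "\<mu> \<noteq> 0" "\<And>y. y \<in> span (range ?D) \<Longrightarrow> orthogonal \<mu> y"
    using orthogonal_to_subspace_exists by blast
  show ?thesis
  proof (rule that[of "\<mu> /\<^sub>R norm \<mu>"])
    show "norm (\<mu> /\<^sub>R norm \<mu>) = 1" using \<mu>(1) by simp
    show "(\<mu> /\<^sub>R norm \<mu>) \<bullet> ?D u = 0" for u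
      using \<mu>(2)[OF span_base, of "?D u"] by (simp add: orthogonal_def)
  qed
qed

lemma differential_rank_full:
  fixes f :: "'a \<Rightarrow> real^'k::finite"
  assumes f: "f \<in> C1_maps A" and c: "c \<in> A" "x \<in> fst c"
    and "\<And>\<mu>. (\<And>u. \<mu> \<bullet> differential A f x (coord_vector A c x u) = 0) \<Longrightarrow> \<mu> = 0"
  shows "differential_rank A f x = CARD('k)"
proof (rule ccontr)
  assume "differential_rank A f x \<noteq> CARD('k)"
  moreover have "differential_rank A f x \<le> CARD('k)"
    unfolding differential_rank_def using dim_subset_UNIV_cart by blast
  ultimately have "differential_rank A f x < CARD('k)" by simp
  from differential_rank_deficient[OF f c this] obtain \<mu> where
    "norm \<mu> = 1" "\<And>u. \<mu> \<bullet> differential A f x (coord_vector A c x u) = 0" by blast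
  then show False using assms(4)[of \<mu>] by simp
qed

end

section \<open>Condition number and Betti numbers of the packed map\<close>

text \<open>The map on the manifold is built from a family of disjoint balls inside a compact part \<open>K\<close> of
  the coordinate domain of one chart, so that it is constant near the boundary of that
  chart.\<close>

locale dented_function = compact_riemannian_manifold M A g
  for M :: "'a topology" and A :: "('a, 'm::finite) chart set" and g +
  fixes c :: "('a, 'm) chart" and K :: "(real^'m) set" and k0 :: "'k::finite" and \<iota> :: "'k \<Rightarrow> 'm"
    and \<epsilon> :: real and I :: "'i set" and p :: "'i \<Rightarrow> real^'m"
  assumes c: "c \<in> A" and K: "compact K" "K \<subseteq> snd c ` fst c" and inj: "inj \<iota>"
    and \<epsilon>: "\<epsilon> > 0" and fin: "finite I"
    and sep: "\<And>v w. v \<in> I \<Longrightarrow> w \<in> I \<Longrightarrow> v \<noteq> w \<Longrightarrow> dist (p v) (p w) \<ge> 2 * \<epsilon>"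
    and balls: "\<And>v. v \<in> I \<Longrightarrow> ball (p v) \<epsilon> \<subseteq> K"
begin

definition f :: "'a \<Rightarrow> real^'k" where
  "f = chart_extend c (dented k0 \<iota> \<epsilon> I p) (\<epsilon> *\<^sub>R axis k0 1)"

lemma dented_outside_balls:
  assumes "y \<notin> (\<Union>v\<in>I. ball (p v) \<epsilon>)"
  shows "dented k0 \<iota> \<epsilon> I p y = \<epsilon> *\<^sub>R axis k0 1" "dented_deriv k0 \<iota> \<epsilon> I p y = (\<lambda>u. 0)"
  using assms by (auto intro!: dented_outside[OF \<epsilon>] simp: not_less)

lemma dented_outside_K: "y \<notin> K \<Longrightarrow> dented k0 \<iota> \<epsilon> I p y = \<epsilon> *\<^sub>R axis k0 1"
  using balls by (intro dented_outside_balls) blast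

lemmas extend = c K has_derivative_dented[OF \<epsilon>, of k0 \<iota> I p] continuous_on_dented_deriv dented_outside_K

lemma f_C1: "f \<in> C1_maps A"
  unfolding f_def by (rule chart_extend_C1[OF extend])

lemma f_in_chart: "x \<in> fst c \<Longrightarrow> f x = dented k0 \<iota> \<epsilon> I p (snd c x)"
  by (simp add: f_def chart_extend_def)

lemma f_outside_K: "\<not> (x \<in> fst c \<and> snd c x \<in> K) \<Longrightarrow> f x = \<epsilon> *\<^sub>R axis k0 1"
  using dented_outside_K[of "snd c x"] by (auto simp: f_def chart_extend_def)

lemma differential_f:
  "x \<in> fst c \<Longrightarrow> differential A f x (coord_vector A c x u) = dented_deriv k0 \<iota> \<epsilon> I p (snd c x) u"
  unfolding f_def by (rule differential_chart_extend[OF extend])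

lemma differential_f_outside_K:
  "x \<in> topspace M \<Longrightarrow> \<not> (x \<in> fst c \<and> snd c x \<in> K) \<Longrightarrow> v \<in> tangent_space A x \<Longrightarrow> differential A f x v = 0"
  unfolding f_def by (rule differential_chart_extend_outside[OF extend])

lemma f_local_model:
  assumes x: "x \<in> fst c"
  obtains z where "norm z \<le> 1" "f x = \<epsilon> *\<^sub>R (axis k0 1 + dent k0 \<iota> z)"
    "\<And>u. differential A f x (coord_vector A c x u) = dent_deriv k0 \<iota> z u"
proof -
  obtain z where "norm z \<le> 1" "dented k0 \<iota> \<epsilon> I p (snd c x) = \<epsilon> *\<^sub>R (axis k0 1 + dent k0 \<iota> z)"
    "dented_deriv k0 \<iota> \<epsilon> I p (snd c x) = dent_deriv k0 \<iota> z"
    by (rule dented_local_model[OF \<epsilon> fin sep])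
  then show ?thesis
    using that[of z] f_in_chart[OF x] differential_f[OF x] by simp
qed

text \<open>Outside the balls \<open>f\<close> is the non-zero constant \<open>\<epsilon> *\<^sub>R axis k0 1\<close>.\<close>

lemma zero_in_ball:
  assumes "f x = 0"
  shows "x \<in> fst c \<and> snd c x \<in> (\<Union>v\<in>I. ball (p v) \<epsilon>)"
proof (rule ccontr)
  assume *: "\<not> ?thesis"
  have "f x = \<epsilon> *\<^sub>R axis k0 1"
  proof (cases "x \<in> fst c")
    case True
    then show ?thesis using * dented_outside_balls(1)[of "snd c x"] f_in_chart by simp
  next
    case False
    then show ?thesis using f_outside_K by blast
  qed
  then show False using assms \<epsilon> by (simp add: axis_eq_0_iff)
qed

lemma regular_zero_set_f: "regular_zero_set M A f"
  unfolding regular_zero_set_def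
proof
  fix x assume "x \<in> zero_set M f"
  then have fx: "f x = 0" by (simp add: zero_set_def)
  then have x: "x \<in> fst c" using zero_in_ball by blast
  obtain z where z: "f x = \<epsilon> *\<^sub>R (axis k0 1 + dent k0 \<iota> z)"
    "\<And>u. differential A f x (coord_vector A c x u) = dent_deriv k0 \<iota> z u"
    using f_local_model[OF x] by blast
  show "differential_rank A f x = CARD('k)"
  proof (rule differential_rank_full[OF f_C1 c x])
    fix \<mu> assume "\<And>u. \<mu> \<bullet> differential A f x (coord_vector A c x u) = 0"
    then show "\<mu> = 0"
      using z fx \<epsilon> by (intro dent_regular_zero[OF inj, of k0 z \<mu>]) auto
  qed
qed

lemma zero_in_each_ball:
  assumes v: "v \<in> I"
  obtains x where "x \<in> zero_set M f" "x \<in> fst c" "snd c x \<in> ball (p v) \<epsilon>"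
proof -
  obtain z where z: "norm z < 1" "axis k0 1 + dent k0 \<iota> z = 0" by (rule dent_zero_exists[OF inj])
  let ?y = "p v + \<epsilon> *\<^sub>R z"
  have y: "?y \<in> ball (p v) \<epsilon>" using z(1) \<epsilon> by (simp add: dist_norm)
  then have "?y \<in> snd c ` fst c" using balls[OF v] K(2) by (meson subsetD)
  then obtain x where x: "x \<in> fst c" "snd c x = ?y"
    by auto
  have "f x = \<epsilon> *\<^sub>R (axis k0 1 + dent k0 \<iota> ((?y - p v) /\<^sub>R \<epsilon>))"
    unfolding f_in_chart[OF x(1)] x(2) using y by (intro dented_in_ball[OF \<epsilon> fin sep v]) auto
  then have "f x = 0" using z(2) \<epsilon> by simp
  moreover have "x \<in> topspace M" using x(1) chart_subset[OF c] by blast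
  ultimately have "x \<in> zero_set M f" by (simp add: zero_set_def)
  then show ?thesis using that[of x] x y by simp
qed

lemma total_betti_zero_set: "enat (card I) \<le> total_betti (subtopology M (zero_set M f))"
proof (rule total_betti_ge_card[OF fin])
  let ?U = "\<lambda>v. {x \<in> fst c. snd c x \<in> ball (p v) \<epsilon>} \<inter> zero_set M f"
  show "openin (subtopology M (zero_set M f)) (?U v)" for v
    using openin_chart_vimage[OF c open_ball] by (rule openin_subtopology_Int)
  show "?U v \<inter> ?U w = {}" if "v \<in> I" "w \<in> I" "v \<noteq> w" for v w
  proof -
    have "ball (p v) \<epsilon> \<inter> ball (p w) \<epsilon> = {}"
      using sep[OF that] by (intro disjoint_ballI) simp
    then show ?thesis by blast
  qed
  show "topspace (subtopology M (zero_set M f)) \<subseteq> (\<Union>v\<in>I. ?U v)"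
    using zero_in_ball by (auto simp: zero_set_def)
  show "?U v \<noteq> {}" if "v \<in> I" for v
    using zero_in_each_ball[OF that] by blast
qed

text \<open>The constants \<open>a\<close>, \<open>b\<close> compare the metric on \<open>K\<close> with the Euclidean one,
  \<open>C\<close> bounds the model, and \<open>c0\<close> measures its non-degeneracy.  They are free of \<open>\<epsilon>\<close> and of
  the balls; hence the estimates below are uniform along the sequence.\<close>

context
  fixes a b C c0
  assumes metric_bounds: "a > 0" "b > 0"
    "\<And>x u. x \<in> fst c \<Longrightarrow> snd c x \<in> K \<Longrightarrow> a * norm u \<le> metric_norm c x u \<and> metric_norm c x u \<le> b * norm u"
    and C: "C \<ge> 1" "\<And>z. norm z \<le> 1 \<Longrightarrow> norm (axis k0 1 + dent k0 \<iota> z) \<le> C"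
    "\<And>z u. norm z \<le> 1 \<Longrightarrow> norm (dent_deriv k0 \<iota> z u) \<le> C * norm u"
    and c0: "c0 > 0" "c0 \<le> 1"
    "\<And>z \<mu>. norm z \<le> 1 \<Longrightarrow> norm \<mu> = 1 \<Longrightarrow> c0 \<le> norm (axis k0 1 + dent k0 \<iota> z) + norm (dent_grad k0 \<iota> z \<mu>)"
begin

lemma C1_norm_f_le: "C1_norm M A g f \<le> \<epsilon> * C + C / a"
proof (rule C1_norm_le)
  fix x assume xM: "x \<in> topspace M"
  show "norm (f x) \<le> \<epsilon> * C"
  proof (cases "x \<in> fst c")
    case True
    then obtain z where "norm z \<le> 1" "f x = \<epsilon> *\<^sub>R (axis k0 1 + dent k0 \<iota> z)"
      using f_local_model by blast
    then show ?thesis using C(2)[of z] \<epsilon> by simp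
  next
    case False
    then have "norm (f x) = \<epsilon>" using f_outside_K[of x] \<epsilon> by (simp add: norm_axis_1)
    then show ?thesis using C(1) \<epsilon> by simp
  qed
  fix v assume v: "v \<in> tangent_space A x"
  show "norm (differential A f x v) \<le> C / a * sqrt (g x v v)"
  proof (cases "x \<in> fst c \<and> snd c x \<in> K")
    case True
    then obtain z where z: "norm z \<le> 1" "\<And>u. differential A f x (coord_vector A c x u) = dent_deriv k0 \<iota> z u"
      using f_local_model[of x] by blast
    obtain u where u: "v = coord_vector A c x u"
      using v True tangent_space_eq[OF c] by blast
    have "norm (differential A f x v) \<le> C * norm u" unfolding u z(2) using C(3)[OF z(1)] .
    also have "\<dots> \<le> C * (metric_norm c x u / a)"
      using metric_bounds(1) metric_bounds(3)[of x u] True C(1) by (intro mult_left_mono) (simp_all add: field_simps)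
    also have "\<dots> = C / a * sqrt (g x v v)" by (simp add: u metric_norm_def)
    finally show ?thesis .
  next
    case False
    obtain d where d: "d \<in> A" "x \<in> fst d" using chart_at[OF xM] by blast
    obtain u where u: "v = coord_vector A d x u" using v unfolding tangent_space_eq[OF d] by blast
    have "sqrt (g x v v) \<ge> 0" using metric_norm_nonneg[OF d, of u] by (simp add: u metric_norm_def)
    then show ?thesis
      using differential_f_outside_K[OF xM False v] C(1) metric_bounds(1) by simp
  qed
qed

text \<open>The uniform bound of the model, carried over to the manifold: if along \<open>\<mu>\<close> the derivative of
  \<open>f\<close> has Riemannian norm at most \<open>N\<close>, then its Euclidean gradient is at most \<open>N * b\<close>.  For \<open>\<mu>\<close>
  arbitrary at a zero of \<open>f\<close> this bounds the \<open>C\<^sup>1\<close> norm from below; for \<open>\<mu>\<close> normal to the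
  range of the differential of a degenerate map it bounds the distance to that map.\<close>

lemma nondegeneracy_estimate:
  assumes x: "x \<in> fst c" "snd c x \<in> K" and "norm \<mu> = 1"
    and N: "norm (f x) \<le> N" "\<And>u. \<bar>\<mu> \<bullet> differential A f x (coord_vector A c x u)\<bar> \<le> N * metric_norm c x u"
  shows "c0 \<le> norm (f x) / \<epsilon> + N * b"
proof -
  obtain z where z: "norm z \<le> 1" "f x = \<epsilon> *\<^sub>R (axis k0 1 + dent k0 \<iota> z)"
    "\<And>u. differential A f x (coord_vector A c x u) = dent_deriv k0 \<iota> z u"
    using f_local_model[OF x(1)] by blast
  let ?u = "dent_grad k0 \<iota> z \<mu>"
  have N0: "N \<ge> 0" using N(1) norm_ge_zero[of "f x"] by linarith
  have "norm ?u * norm ?u = \<mu> \<bullet> dent_deriv k0 \<iota> z ?u"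
    by (simp add: inner_dent_grad[symmetric] dot_square_norm power2_eq_square)
  also have "\<dots> \<le> N * metric_norm c x ?u" using N(2)[of ?u] z(3) by simp
  also have "\<dots> \<le> N * b * norm ?u"
    using mult_left_mono[OF _ N0, of "metric_norm c x ?u" "b * norm ?u"] metric_bounds(3)[OF x] by simp
  finally have "norm ?u \<le> N * b"
    using N0 metric_bounds(2) by (cases "?u = 0") auto
  moreover have "norm (axis k0 1 + dent k0 \<iota> z) = norm (f x) / \<epsilon>"
    using z(2) \<epsilon> by simp
  ultimately show ?thesis using c0(3)[OF z(1) assms(3)] by simp
qed

lemma C1_norm_f_ge:
  assumes "I \<noteq> {}"
  shows "c0 \<le> C1_norm M A g f * b"
proof -
  obtain v where v: "v \<in> I" using assms by blast
  obtain x where x: "x \<in> zero_set M f" "x \<in> fst c" "snd c x \<in> ball (p v) \<epsilon>" by (rule zero_in_each_ball[OF v])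
  have fx: "f x = 0" and xM: "x \<in> topspace M" using x(1) by (auto simp: zero_set_def)
  have "c0 \<le> norm (f x) / \<epsilon> + C1_norm M A g f * b"
  proof (rule nondegeneracy_estimate[of x "axis k0 1"])
    show "\<bar>axis k0 1 \<bullet> differential A f x (coord_vector A c x u)\<bar> \<le> C1_norm M A g f * metric_norm c x u" for u
      using Cauchy_Schwarz_ineq2[of "axis k0 1" "differential A f x (coord_vector A c x u)"]
        differential_le_C1_norm[OF f_C1 c x(2), of u] by (simp add: norm_axis_1)
  qed (use x balls[OF v] xM norm_le_C1_norm[OF f_C1] in \<open>auto simp: norm_axis_1\<close>)
  then show ?thesis using fx by simp
qed

text \<open>At a degenerate zero \<open>x\<close> of \<open>h\<close> the norm of \<open>f x\<close> is at most the distance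
  between \<open>f\<close> and \<open>h\<close>, and so is the derivative of \<open>f\<close> along a unit normal to the range of the
  differential of \<open>h\<close>.  The values of the model are those of \<open>f\<close> divided by \<open>\<epsilon>\<close>, whence the
  factor \<open>1 / \<epsilon> + b\<close>.  If \<open>x\<close> lies off \<open>K\<close>, then \<open>f x\<close> has norm \<open>\<epsilon>\<close>, and the values
  alone give the bound.\<close>

lemma discriminant_far:
  assumes h: "h \<in> discriminant M A"
  shows "c0 \<le> C1_norm M A g (\<lambda>x. f x - h x) * (1 / \<epsilon> + b)"
proof -
  let ?N = "C1_norm M A g (\<lambda>x. f x - h x)"
  obtain x where hC1: "h \<in> C1_maps A" and x: "x \<in> topspace M" "h x = 0" "differential_rank A h x < CARD('k)"
    using h unfolding discriminant_def by blast
  note dC1 = C1_maps_diff[OF f_C1 hC1]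
  have fx: "norm (f x) \<le> ?N" using norm_le_C1_norm[OF dC1 x(1)] x(2) by simp
  have N0: "?N \<ge> 0" by (rule C1_norm_nonneg[OF dC1])
  show ?thesis
  proof (cases "x \<in> fst c \<and> snd c x \<in> K")
    case True
    then have xc: "x \<in> fst c" by simp
    obtain \<mu> where \<mu>: "norm \<mu> = 1" "\<And>u. \<mu> \<bullet> differential A h x (coord_vector A c x u) = 0"
      using differential_rank_deficient[OF hC1 c xc x(3)] by blast
    have "c0 \<le> norm (f x) / \<epsilon> + ?N * b"
    proof (rule nondegeneracy_estimate[OF _ _ \<mu>(1) fx])
      fix u
      have "\<mu> \<bullet> differential A f x (coord_vector A c x u) = \<mu> \<bullet> differential A (\<lambda>x. f x - h x) x (coord_vector A c x u)"
        using \<mu>(2)[of u] by (simp add: differential_diff[OF f_C1 hC1 c xc] inner_diff_right)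
      also have "\<bar>\<dots>\<bar> \<le> norm (differential A (\<lambda>x. f x - h x) x (coord_vector A c x u))"
        using Cauchy_Schwarz_ineq2[of \<mu> "differential A (\<lambda>x. f x - h x) x (coord_vector A c x u)"] \<mu>(1) by simp
      also have "\<dots> \<le> ?N * metric_norm c x u" by (rule differential_le_C1_norm[OF dC1 c xc])
      finally show "\<bar>\<mu> \<bullet> differential A f x (coord_vector A c x u)\<bar> \<le> ?N * metric_norm c x u" .
    qed (use True in auto)
    also have "\<dots> \<le> ?N * (1 / \<epsilon> + b)"
      using fx \<epsilon> by (simp add: field_simps)
    finally show ?thesis .
  next
    case False
    then have "norm (f x) = \<epsilon>" using f_outside_K[of x] \<epsilon> by (simp add: norm_axis_1)
    then have "1 \<le> ?N / \<epsilon>" using fx \<epsilon> by (simp add: field_simps)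
    also have "\<dots> \<le> ?N * (1 / \<epsilon> + b)"
      using N0 metric_bounds(2) by (simp add: distrib_left)
    finally show ?thesis using c0(2) by linarith
  qed
qed

text \<open>Subtracting the constant value of \<open>f\<close> off the balls makes both value and derivative vanish at
  \<open>q\<close>, where the differential then has rank \<open>0 < k\<close>.\<close>

lemma discriminant_near:
  assumes q: "q \<in> K" "q \<notin> (\<Union>v\<in>I. ball (p v) \<epsilon>)"
  obtains h where "h \<in> discriminant M A" "C1_norm M A g (\<lambda>x. f x - h x) \<le> \<epsilon>"
proof -
  let ?e = "\<epsilon> *\<^sub>R axis k0 1 :: real^'k"
  let ?h = "\<lambda>x. f x - ?e"
  obtain x where x: "x \<in> fst c" "snd c x = q" using q(1) K by blast
  have xM: "x \<in> topspace M" using x c chart_subset by blast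
  have "differential A ?h x (coord_vector A c x u) = 0" for u
    using differential_diff[OF f_C1 C1_maps_const c x(1)] differential_f[OF x(1), of u] x(2)
      dented_outside_balls(2)[OF q(2)] differential_const[OF xM coord_vector_in_tangent_space[OF c x(1)]]
    by simp
  then have "differential A ?h x ` tangent_space A x \<subseteq> {0}"
    unfolding tangent_space_eq[OF c x(1)] by auto
  then have "differential_rank A ?h x = 0"
    unfolding differential_rank_def dim_eq_0 .
  moreover have "?h x = 0"
    using f_in_chart[OF x(1)] dented_outside_balls(1)[OF q(2)] x(2) by simp
  moreover have "?h \<in> C1_maps A" by (intro C1_maps_diff f_C1 C1_maps_const)
  ultimately have "?h \<in> discriminant M A"
    using xM unfolding discriminant_def by force
  moreover have "C1_norm M A g (\<lambda>x. f x - ?h x) \<le> \<epsilon> + 0"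
  proof (rule C1_norm_le)
    show "norm (f x - ?h x) \<le> \<epsilon>" for x using \<epsilon> by (simp add: norm_axis_1)
    show "norm (differential A (\<lambda>x. f x - ?h x) x v) \<le> 0 * sqrt (g x v v)"
      if "x \<in> topspace M" "v \<in> tangent_space A x" for x v
      using differential_const[OF that, of ?e] by simp
  qed
  ultimately show ?thesis using that[of ?h] by simp
qed

lemma condition_number_bounds:
  assumes q: "q \<in> K" "q \<notin> (\<Union>v\<in>I. ball (p v) \<epsilon>)" and "I \<noteq> {}"
  shows "c0 / b / \<epsilon> \<le> condition_number M A g f"
    "condition_number M A g f \<le> (\<epsilon> * C + C / a) * (1 / \<epsilon> + b) / c0"
proof -
  let ?\<delta> = "discriminant_dist M A g f"
  let ?S = "(\<lambda>h. C1_norm M A g (\<lambda>x. f x - h x)) ` discriminant M A"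
  obtain h where h: "h \<in> discriminant M A" "C1_norm M A g (\<lambda>x. f x - h x) \<le> \<epsilon>"
    by (rule discriminant_near[OF q])
  have pos: "1 / \<epsilon> + b > 0" using \<epsilon> metric_bounds(2) by (simp add: add_pos_pos)
  have low: "c0 / (1 / \<epsilon> + b) \<le> C1_norm M A g (\<lambda>x. f x - h x)" if "h \<in> discriminant M A" for h
    using discriminant_far[OF that] pos by (simp add: pos_divide_le_eq)
  then have "bdd_below ?S" by (intro bdd_belowI2[of _ "c0 / (1 / \<epsilon> + b)"])
  then have "?\<delta> \<le> C1_norm M A g (\<lambda>x. f x - h x)"
    unfolding discriminant_dist_def using h(1) by (rule cINF_lower)
  then have le: "?\<delta> \<le> \<epsilon>" using h(2) by simp
  have ge: "c0 / (1 / \<epsilon> + b) \<le> ?\<delta>"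
    unfolding discriminant_dist_def using h(1) low by (intro cINF_greatest) auto
  have d0: "0 < c0 / (1 / \<epsilon> + b)" using pos c0(1) by simp
  then have dpos: "?\<delta> > 0" using ge by linarith
  have "c0 / b \<le> C1_norm M A g f"
    using C1_norm_f_ge[OF assms(3)] metric_bounds(2) by (simp add: pos_divide_le_eq)
  then have "c0 / b / \<epsilon> \<le> C1_norm M A g f / ?\<delta>"
    using le dpos C1_norm_nonneg[OF f_C1] by (intro frac_le) auto
  then show "c0 / b / \<epsilon> \<le> condition_number M A g f" by (simp add: condition_number_def)
  have "C1_norm M A g f / ?\<delta> \<le> (\<epsilon> * C + C / a) / (c0 / (1 / \<epsilon> + b))"
    using C1_norm_f_le C1_norm_nonneg[OF f_C1] ge d0 by (intro frac_le) auto
  then show "condition_number M A g f \<le> (\<epsilon> * C + C / a) * (1 / \<epsilon> + b) / c0"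
    by (simp add: condition_number_def)
qed

end

end

section \<open>Packing and the conclusion\<close>

text \<open>The centres are the points of the lattice \<open>2 \<epsilon> \<int>\<^sup>m\<close> around \<open>q\<close> with all coordinates in
  \<open>{1..N}\<close>.  Starting at \<open>1\<close> instead of \<open>0\<close> leaves \<open>q\<close> itself uncovered; it is the point where the
  nearby degenerate map has its zero.\<close>

lemma lattice_packing:
  fixes q :: "real^'m::finite" and N :: nat and \<epsilon> R :: real
  defines "I \<equiv> (UNIV :: 'm set) \<rightarrow>\<^sub>E {1..N}"
    and "p \<equiv> \<lambda>v. q + (2 * \<epsilon>) *\<^sub>R (\<chi> i. real (v i))"
  assumes \<epsilon>: "\<epsilon> > 0" and R: "\<epsilon> * (2 * CARD('m) * N + 1) \<le> R"
  shows "finite I" "card I = N ^ CARD('m)"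
    and "\<And>v w. v \<in> I \<Longrightarrow> w \<in> I \<Longrightarrow> v \<noteq> w \<Longrightarrow> dist (p v) (p w) \<ge> 2 * \<epsilon>"
    and "\<And>v. v \<in> I \<Longrightarrow> ball (p v) \<epsilon> \<subseteq> cball q R"
    and "\<And>v. v \<in> I \<Longrightarrow> q \<notin> ball (p v) \<epsilon>"
proof -
  show "finite I" "card I = N ^ CARD('m)"
    by (auto simp: I_def card_PiE intro: finite_PiE)
  have dist_p: "dist (p v) y = norm (p v - y)" for v y by (simp add: dist_norm)
  show "dist (p v) (p w) \<ge> 2 * \<epsilon>" if vw: "v \<noteq> w" for v w
  proof -
    obtain i where i: "v i \<noteq> w i" using vw by (auto simp: fun_eq_iff)
    have "1 \<le> \<bar>real (v i) - real (w i)\<bar>" using i by linarith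
    then have "2 * \<epsilon> \<le> \<bar>(p v - p w) $ i\<bar>"
      using \<epsilon> by (simp add: p_def right_diff_distrib[symmetric] abs_mult)
    also have "\<dots> \<le> norm (p v - p w)" by (rule component_le_norm_cart)
    finally show ?thesis by (simp add: dist_norm)
  qed
  have shift: "p v - q = (2 * \<epsilon>) *\<^sub>R (\<chi> i. real (v i))" for v by (simp add: p_def)
  show "ball (p v) \<epsilon> \<subseteq> cball q R" if v: "v \<in> I" for v
  proof
    fix y assume "y \<in> ball (p v) \<epsilon>"
    then have y: "dist (p v) y < \<epsilon>" by simp
    have "norm (\<chi> i. real (v i)) \<le> (\<Sum>i\<in>UNIV. \<bar>(\<chi> i. real (v i)) $ i\<bar>)" by (rule norm_le_l1_cart)
    also have "\<dots> \<le> (\<Sum>i\<in>(UNIV::'m set). real N)" using v by (intro sum_mono) (auto simp: I_def)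
    finally have "2 * \<epsilon> * norm (\<chi> i. real (v i)) \<le> 2 * \<epsilon> * (CARD('m) * N)"
      using \<epsilon> by (intro mult_left_mono) auto
    then have "dist q (p v) \<le> 2 * \<epsilon> * (CARD('m) * N)"
      using \<epsilon> by (simp add: dist_norm norm_minus_commute[of q] shift)
    then have "dist q y \<le> \<epsilon> * (2 * CARD('m) * N + 1)"
      using dist_triangle[of q y "p v"] y by (simp add: algebra_simps)
    then show "y \<in> cball q R" using R by simp
  qed
  show "q \<notin> ball (p v) \<epsilon>" if v: "v \<in> I" for v
  proof -
    have "1 \<le> real (v undefined)" using v by (auto simp: I_def)
    then have "\<epsilon> \<le> (2 * \<epsilon>) * real (v undefined)" using \<epsilon> mult_left_mono[of 1 "real (v undefined)" "2 * \<epsilon>"] by simp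
    also have "\<dots> \<le> \<bar>(p v - q) $ undefined\<bar>" using \<epsilon> by (simp add: shift)
    also have "\<dots> \<le> norm (p v - q)" by (rule component_le_norm_cart)
    finally show ?thesis by (simp add: dist_norm)
  qed
qed

text \<open>With \<open>N\<close> balls along each axis, their radius \<open>\<epsilon>\<close> is a constant divided by \<open>N\<close>, so the
  condition number is of order \<open>N\<close> and the number of components is \<open>N ^ m\<close>.\<close>

lemma (in compact_riemannian_manifold) ill_conditioned_functions:
  assumes dims: "CARD('k::finite) \<le> CARD('m)"
  obtains l U B :: real where "l > 0" "U > 0"
    "\<And>N. N \<ge> 1 \<Longrightarrow> \<exists>f :: 'a \<Rightarrow> real^'k. f \<in> C1_maps A \<and> C1_norm M A g f \<le> B \<and> regular_zero_set M A f \<and>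
      l * N \<le> condition_number M A g f \<and> condition_number M A g f \<le> U * N \<and>
      enat (N ^ CARD('m)) \<le> total_betti (subtopology M (zero_set M f))"
proof -
  obtain \<iota> :: "'k \<Rightarrow> 'm" where inj: "inj \<iota>"
    using card_le_inj[of "UNIV :: 'k set" "UNIV :: 'm set"] dims by auto
  define k0 :: 'k where "k0 = undefined"
  obtain x where "x \<in> topspace M" using nonempty by blast
  then obtain c where c: "c \<in> A" "x \<in> fst c" using chart_at by blast
  define q where "q = snd c x"
  obtain R where R: "R > 0" "cball q R \<subseteq> snd c ` fst c"
    using open_chart_image[OF c(1)] c(2) unfolding open_contains_cball q_def by blast
  obtain a b where ab: "a > 0" "b > 0"
    "\<And>x u. x \<in> fst c \<Longrightarrow> snd c x \<in> cball q R \<Longrightarrow> a * norm u \<le> metric_norm c x u \<and> metric_norm c x u \<le> b * norm u"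
    using metric_norm_bounds[OF c(1) compact_cball R(2)] by blast
  obtain C where C: "C \<ge> 1" "\<And>z. norm z \<le> 1 \<Longrightarrow> norm (axis k0 1 + dent k0 \<iota> z) \<le> C"
    "\<And>z u. norm z \<le> 1 \<Longrightarrow> norm (dent_deriv k0 \<iota> z u) \<le> C * norm u"
    using dent_bounded[of k0 \<iota>] by blast
  obtain c0 where c0: "c0 > 0" "c0 \<le> 1"
    "\<And>z \<mu>. norm z \<le> 1 \<Longrightarrow> norm \<mu> = 1 \<Longrightarrow> c0 \<le> norm (axis k0 1 + dent k0 \<iota> z) + norm (dent_grad k0 \<iota> z \<mu>)"
    using dent_nondegenerate[OF inj, of k0] by blast
  \<comment> \<open>A ball of radius \<open>r / N\<close> around a lattice point stays in \<open>cball q R\<close>, because the \<open>l\<^sup>1\<close> norm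
    bounds the distance of a centre from \<open>q\<close> by \<open>2 r m\<close>.\<close>
  define r where "r = min 1 (R / (2 * CARD('m) + 1))"
  have r: "0 < r" "r \<le> 1" "r * (2 * CARD('m) + 1) \<le> R"
  proof -
    have "r * (2 * CARD('m) + 1) \<le> R / (2 * CARD('m) + 1) * (2 * CARD('m) + 1)"
      by (intro mult_right_mono) (auto simp: r_def)
    then show "r * (2 * CARD('m) + 1) \<le> R" by simp
  qed (use R in \<open>auto simp: r_def\<close>)
  show ?thesis
  proof (rule that[of "c0 / b / r" "(C + C / a) * (1 + b) / c0 / r" "C + C / a"])
    show "c0 / b / r > 0" using c0 ab r by simp
    show "(C + C / a) * (1 + b) / c0 / r > 0" using C(1) c0 ab r by (simp add: add_pos_pos)
    fix N :: nat assume N: "N \<ge> 1"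
    define \<epsilon> where "\<epsilon> = r / N"
    have \<epsilon>: "\<epsilon> > 0" "\<epsilon> \<le> 1" using r N by (auto simp: \<epsilon>_def divide_le_eq)
    have "\<epsilon> * (2 * CARD('m) * N + 1) \<le> \<epsilon> * (2 * CARD('m) * N + N)"
      using \<epsilon> N by (intro mult_left_mono) auto
    also have "\<dots> = r * (2 * CARD('m) + 1)" using N by (simp add: \<epsilon>_def field_simps)
    finally have fit: "\<epsilon> * (2 * CARD('m) * N + 1) \<le> R" using r(3) by linarith
    let ?I = "(UNIV :: 'm set) \<rightarrow>\<^sub>E {1..N}"
    let ?p = "\<lambda>v. q + (2 * \<epsilon>) *\<^sub>R (\<chi> i. real (v i))"
    note I = lattice_packing(1,2)[OF \<epsilon>(1) fit] and packing = lattice_packing(3-5)[OF \<epsilon>(1) fit, where q = q]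
    interpret D: dented_function M A g c "cball q R" k0 \<iota> \<epsilon> ?I ?p
      by unfold_locales (use c(1) R(2) inj \<epsilon>(1) I packing in auto)
    have qK: "q \<in> cball q R" "q \<notin> (\<Union>v\<in>?I. ball (?p v) \<epsilon>)"
      using R packing(3) by auto
    have ne: "?I \<noteq> {}" using N by (simp add: PiE_eq_empty_iff)
    note bounds = D.condition_number_bounds[OF ab C c0 qK ne]
    have "c0 / b / r * N \<le> condition_number M A g D.f"
      using bounds(1) by (simp add: \<epsilon>_def)
    moreover have "condition_number M A g D.f \<le> (C + C / a) * (1 + b) / c0 / r * N"
    proof -
      have "(\<epsilon> * C + C / a) * (1 / \<epsilon> + b) \<le> (C + C / a) * ((1 + b) / \<epsilon>)"
      proof (intro mult_mono add_right_mono)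
        show "\<epsilon> * C \<le> C" using \<epsilon> C(1) by simp
        show "1 / \<epsilon> + b \<le> (1 + b) / \<epsilon>" using \<epsilon> ab(2) by (simp add: field_simps)
      qed (use \<epsilon> C(1) ab in auto)
      then have "(\<epsilon> * C + C / a) * (1 / \<epsilon> + b) / c0 \<le> (C + C / a) * ((1 + b) / \<epsilon>) / c0"
        using c0(1) by (intro divide_right_mono) auto
      also have "\<dots> = (C + C / a) * (1 + b) / c0 / r * N" by (simp add: \<epsilon>_def mult_ac)
      finally show ?thesis using bounds(2) by linarith
    qed
    moreover have "C1_norm M A g D.f \<le> C + C / a"
    proof -
      have "\<epsilon> * C \<le> C" using \<epsilon> C(1) by simp
      then show ?thesis using D.C1_norm_f_le[OF ab C c0] by linarith
    qed
    ultimately show "\<exists>f :: 'a \<Rightarrow> real^'k. f \<in> C1_maps A \<and> C1_norm M A g f \<le> C + C / a \<and> regular_zero_set M A f \<and>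
      c0 / b / r * N \<le> condition_number M A g f \<and> condition_number M A g f \<le> (C + C / a) * (1 + b) / c0 / r * N \<and>
      enat (N ^ CARD('m)) \<le> total_betti (subtopology M (zero_set M f))"
      using D.f_C1 D.regular_zero_set_f D.total_betti_zero_set I(2) by (intro exI[of _ D.f]) simp
  qed
qed

theorem proposition3p2:
  fixes M :: "'a topology"
    and A :: "('a, 'm::finite) chart set"
    and g :: "('a, 'm) metric_tensor"
  assumes "smooth_manifold M A"
    and "compact_space M"
    and "topspace M \<noteq> {}"
    and "riemannian_metric M A g"
    and "1 \<le> CARD('k::finite)"
    and "CARD('k) \<le> CARD('m)"
  shows "\<exists>(f :: nat \<Rightarrow> 'a \<Rightarrow> real^'k) (c2 :: real).
           (\<forall>n. f n \<in> C1_maps A) \<and>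
           (\<exists>B. \<forall>n. C1_norm M A g (f n) \<le> B) \<and>
           filterlim (\<lambda>n. condition_number M A g (f n)) at_top sequentially \<and>
           c2 > 0 \<and>
           (\<forall>n. regular_zero_set M A (f n) \<and>
                ereal_of_enat (total_betti (subtopology M (zero_set M (f n))))
                  \<ge> ereal (c2 * condition_number M A g (f n) ^ CARD('m)))"
proof -
  interpret compact_riemannian_manifold M A g
    using assms by unfold_locales
  let ?\<kappa> = "condition_number M A g" and ?m = "CARD('m)"
  let ?P = "\<lambda>l U B N f. f \<in> C1_maps A \<and> C1_norm M A g f \<le> B \<and> regular_zero_set M A f \<and>
      l * real N \<le> ?\<kappa> f \<and> ?\<kappa> f \<le> U * real N \<and> enat (N ^ ?m) \<le> total_betti (subtopology M (zero_set M f))"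
  obtain l U B where pos: "l > 0" "U > 0" and ex: "\<And>N. N \<ge> 1 \<Longrightarrow> \<exists>f :: 'a \<Rightarrow> real^'k. ?P l U B N f"
    using ill_conditioned_functions[where 'k = 'k, OF assms(6)] by metis
  have "\<forall>n. \<exists>f :: 'a \<Rightarrow> real^'k. ?P l U B (Suc n) f" by (intro allI ex) simp
  from choice[OF this] obtain f :: "nat \<Rightarrow> 'a \<Rightarrow> real^'k" where f: "\<And>n. ?P l U B (Suc n) (f n)"
    by blast
  have "filterlim (\<lambda>n. ?\<kappa> (f n)) at_top sequentially"
  proof (rule filterlim_at_top_mono)
    show "filterlim (\<lambda>n. l * real (Suc n)) at_top sequentially"
      using pos(1) filterlim_compose[OF filterlim_real_sequentially filterlim_Suc]
      by (intro filterlim_tendsto_pos_mult_at_top[OF tendsto_const])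
    show "\<forall>\<^sub>F n in sequentially. l * real (Suc n) \<le> ?\<kappa> (f n)" using f by simp
  qed
  moreover have "ereal ((1 / U) ^ ?m * ?\<kappa> (f n) ^ ?m)
      \<le> ereal_of_enat (total_betti (subtopology M (zero_set M (f n))))" for n
  proof -
    have "0 \<le> l * real (Suc n)" using pos(1) by simp
    then have "0 \<le> ?\<kappa> (f n)" using f[of n] by linarith
    then have "?\<kappa> (f n) ^ ?m \<le> (U * real (Suc n)) ^ ?m" using f[of n] by (intro power_mono) auto
    then have "(1 / U) ^ ?m * ?\<kappa> (f n) ^ ?m \<le> (1 / U) ^ ?m * (U * real (Suc n)) ^ ?m"
      using pos(2) by (intro mult_left_mono) auto
    also have "\<dots> = real (Suc n ^ ?m)"
      using pos(2) by (simp add: power_mult_distrib[symmetric])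
    finally have "ereal ((1 / U) ^ ?m * ?\<kappa> (f n) ^ ?m) \<le> ereal_of_enat (enat (Suc n ^ ?m))" by simp
    also have "\<dots> \<le> ereal_of_enat (total_betti (subtopology M (zero_set M (f n))))"
      using f[of n] by (simp only: ereal_of_enat_le_iff)
    finally show ?thesis .
  qed
  ultimately show ?thesis
    using f pos(2) by (intro exI[of _ f] exI[of _ "(1 / U) ^ ?m"] conjI exI[of _ B]) auto
qed

end
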